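(* Let $R$ be a local fqf-ring which is not a chain ring. Then each ideal $I$ of $R$ is flat modulo its annihilator, i.e. $I$ is flat as a module over $R/(0:I)$.
   Context: All rings are commutative with unity. A local ring is a ring with exactly one maximal ideal (no Noetherian assumption). A chain ring (valuation ring) is a ring whose ideals are totally ordered by inclusion. $(0:I)=\{r\in R\mid rI=0\}$. For $R$-modules $M$ and $V$, $V$ is $M$-\underline{flat} (the underlining distinguishes this notion from ordinary flatness) if for any $R$-module $M'$, any epimorphism $p:M\rightarrow M'$, any homomorphism $u:V\rightarrow M'$, any finitely presented $R$-module $G$ and any homomorphism $v:G\rightarrow V$, there exists a homomorphism $q:G\rightarrow M$ such that $pq=uv$. $V$ is quasi-flat if $V$ is $V^n$-\underline{flat} for each integer $n>0$. $R$ is an fqf-ring if each finitely generated ideal of $R$ is quasi-flat. *)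

theory Defs
  imports "HOL-Algebra.Module" "HOL-Algebra.QuotRing" "HOL-Algebra.Free_Abelian_Groups"
begin

section \<open>Rings\<close>

definition local_ring :: "('a, 'b) ring_scheme \<Rightarrow> bool" where
  "local_ring R \<longleftrightarrow> cring R \<and> (\<exists>!m. maximalideal m R)"

definition chain_ring :: "('a, 'b) ring_scheme \<Rightarrow> bool" where
  "chain_ring R \<longleftrightarrow> cring R \<and> (\<forall>I J. ideal I R \<longrightarrow> ideal J R \<longrightarrow> I \<subseteq> J \<or> J \<subseteq> I)"

definition fg_ideal :: "'a set \<Rightarrow> ('a, 'b) ring_scheme \<Rightarrow> bool" where
  "fg_ideal I R \<longleftrightarrow> ideal I R \<and> (\<exists>S. finite S \<and> S \<subseteq> carrier R \<and> I = Idl\<^bsub>R\<^esub> S)"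

definition annihilator :: "('a, 'b) ring_scheme \<Rightarrow> 'a set \<Rightarrow> 'a set" where
  "annihilator R I = {r \<in> carrier R. \<forall>x\<in>I. r \<otimes>\<^bsub>R\<^esub> x = \<zero>\<^bsub>R\<^esub>}"


section \<open>Modules\<close>

text \<open>The record type of modules extends that of rings, so module records carry the fields
  \<^term>\<open>monoid.mult\<close> and \<^term>\<open>one\<close>. They play no role in the module axioms;
  below they are filled arbitrarily.\<close>

definition mod_hom ::
  "('a, 'b) ring_scheme \<Rightarrow> ('a, 'm) module \<Rightarrow> ('a, 'n) module \<Rightarrow> ('m \<Rightarrow> 'n) set" where
  "mod_hom R M N = {f \<in> hom (add_monoid M) (add_monoid N).
     \<forall>r\<in>carrier R. \<forall>x\<in>carrier M. f (r \<odot>\<^bsub>M\<^esub> x) = r \<odot>\<^bsub>N\<^esub> f x}"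

definition ideal_module :: "('a, 'b) ring_scheme \<Rightarrow> 'a set \<Rightarrow> ('a, 'a) module" where
  "ideal_module R I = \<lparr>carrier = I, monoid.mult = monoid.mult R, one = \<one>\<^bsub>R\<^esub>, ring.zero = \<zero>\<^bsub>R\<^esub>,
     add = add R, smult = monoid.mult R\<rparr>"

definition direct_power :: "('a, 'm) module \<Rightarrow> nat \<Rightarrow> ('a, nat \<Rightarrow> 'm) module" where
  "direct_power M n = \<lparr>carrier = {..<n} \<rightarrow>\<^sub>E carrier M,
     monoid.mult = (\<lambda>x y. \<lambda>i\<in>{..<n}. x i \<otimes>\<^bsub>M\<^esub> y i), one = (\<lambda>i\<in>{..<n}. \<one>\<^bsub>M\<^esub>),
     ring.zero = (\<lambda>i\<in>{..<n}. \<zero>\<^bsub>M\<^esub>), add = (\<lambda>x y. \<lambda>i\<in>{..<n}. x i \<oplus>\<^bsub>M\<^esub> y i),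
     smult = (\<lambda>r x. \<lambda>i\<in>{..<n}. r \<odot>\<^bsub>M\<^esub> x i)\<rparr>"

definition submodule_span ::
  "('a, 'b) ring_scheme \<Rightarrow> ('a, 'm) module \<Rightarrow> 'm set \<Rightarrow> 'm set" where
  "submodule_span R M S = \<Inter>{H. submodule H R M \<and> S \<subseteq> H}"

definition finitely_presented :: "('a, 'b) ring_scheme \<Rightarrow> ('a, 'm) module \<Rightarrow> bool" where
  "finitely_presented R G \<longleftrightarrow> module R G \<and>
     (\<exists>n. let F = direct_power (ideal_module R (carrier R)) n in
        \<exists>e\<in>mod_hom R F G. e ` carrier F = carrier G \<and>
          (\<exists>S. finite S \<and> S \<subseteq> carrier F \<and>
               {x \<in> carrier F. e x = \<zero>\<^bsub>G\<^esub>} = submodule_span R F S))"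


section \<open>Relative flatness and quasi-flat modules\<close>

text \<open>HOL cannot quantify over types inside a definition. Up to isomorphism, an epimorphic image
  of \<open>M\<close> is a quotient of \<open>M\<close>, whose elements are subsets of \<open>M\<close>; and a finitely presented
  module is a quotient of some finite power of \<open>R\<close>. Hence it suffices to let \<open>M'\<close> and \<open>G\<close> range
  over the modules on the two types below. The lemma \<open>rel_flatD\<close> derives the lifting
  property for \<open>M'\<close> and \<open>G\<close> on arbitrary types.\<close>

definition rel_flat ::
  "('a, 'b) ring_scheme \<Rightarrow> ('a, 'm) module \<Rightarrow> ('a, 'v) module \<Rightarrow> bool" where
  "rel_flat R M V \<longleftrightarrow> module R M \<and> module R V \<and>
     (\<forall>(M' :: ('a, 'm set) module) (G :: ('a, (nat \<Rightarrow> 'a) set) module) p u v.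
        module R M' \<longrightarrow> p \<in> mod_hom R M M' \<longrightarrow> p ` carrier M = carrier M' \<longrightarrow>
        u \<in> mod_hom R V M' \<longrightarrow> finitely_presented R G \<longrightarrow> v \<in> mod_hom R G V \<longrightarrow>
        (\<exists>q\<in>mod_hom R G M. \<forall>x\<in>carrier G. p (q x) = u (v x)))"

definition quasi_flat :: "('a, 'b) ring_scheme \<Rightarrow> ('a, 'v) module \<Rightarrow> bool" where
  "quasi_flat R V \<longleftrightarrow> (\<forall>n>0. rel_flat R (direct_power V n) V)"

definition fqf_ring :: "('a, 'b) ring_scheme \<Rightarrow> bool" where
  "fqf_ring R \<longleftrightarrow> cring R \<and> (\<forall>I. fg_ideal I R \<longrightarrow> quasi_flat R (ideal_module R I))"


section \<open>Tensor products and flat modules\<close>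

definition tensor_relators ::
  "('a, 'b) ring_scheme \<Rightarrow> ('a, 'm) module \<Rightarrow> ('a, 'n) module \<Rightarrow> ('m \<times> 'n \<Rightarrow>\<^sub>0 int) set" where
  "tensor_relators R M N =
     {frag_of (x \<oplus>\<^bsub>M\<^esub> x', y) - frag_of (x, y) - frag_of (x', y) | x x' y.
        x \<in> carrier M \<and> x' \<in> carrier M \<and> y \<in> carrier N} \<union>
     {frag_of (x, y \<oplus>\<^bsub>N\<^esub> y') - frag_of (x, y) - frag_of (x, y') | x y y'.
        x \<in> carrier M \<and> y \<in> carrier N \<and> y' \<in> carrier N} \<union>
     {frag_of (r \<odot>\<^bsub>M\<^esub> x, y) - frag_of (x, r \<odot>\<^bsub>N\<^esub> y) | r x y.
        r \<in> carrier R \<and> x \<in> carrier M \<and> y \<in> carrier N}"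

definition tensor_kernel ::
  "('a, 'b) ring_scheme \<Rightarrow> ('a, 'm) module \<Rightarrow> ('a, 'n) module \<Rightarrow> ('m \<times> 'n \<Rightarrow>\<^sub>0 int) set" where
  "tensor_kernel R M N =
     generate (free_Abelian_group (carrier M \<times> carrier N)) (tensor_relators R M N)"

text \<open>The tensor product as an abelian group; its \<open>R\<close>-action is not needed in order
  to speak about injectivity of induced maps.\<close>

definition tensor_product ::
  "('a, 'b) ring_scheme \<Rightarrow> ('a, 'm) module \<Rightarrow> ('a, 'n) module \<Rightarrow> ('m \<times> 'n \<Rightarrow>\<^sub>0 int) set monoid" where
  "tensor_product R M N =
     free_Abelian_group (carrier M \<times> carrier N) Mod tensor_kernel R M N"

definition tensor_elem ::
  "('a, 'b) ring_scheme \<Rightarrow> ('a, 'm) module \<Rightarrow> ('a, 'n) module \<Rightarrow> 'm \<Rightarrow> 'n \<Rightarrow> ('m \<times> 'n \<Rightarrow>\<^sub>0 int) set"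
  where
  "tensor_elem R M N x y =
     tensor_kernel R M N #>\<^bsub>free_Abelian_group (carrier M \<times> carrier N)\<^esub> frag_of (x, y)"

text \<open>The map \<open>M \<otimes> N \<rightarrow> M \<otimes> N'\<close> induced by \<open>f : N \<rightarrow> N'\<close>. All members of the union are the same
  coset; see \<open>tensor_map_coset\<close>.\<close>

definition tensor_map ::
  "('a, 'b) ring_scheme \<Rightarrow> ('a, 'm) module \<Rightarrow> ('a, 'n) module \<Rightarrow> ('a, 'p) module \<Rightarrow> ('n \<Rightarrow> 'p) \<Rightarrow>
   ('m \<times> 'n \<Rightarrow>\<^sub>0 int) set \<Rightarrow> ('m \<times> 'p \<Rightarrow>\<^sub>0 int) set" where
  "tensor_map R M N N' f X =
     (\<Union>c\<in>X. tensor_kernel R M N' #>\<^bsub>free_Abelian_group (carrier M \<times> carrier N')\<^esub>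
              frag_extend (\<lambda>(x, y). frag_of (x, f y)) c)"

text \<open>Flatness tested on injections \<open>N \<rightarrow> N'\<close> between modules on the types \<open>'n\<close> and \<open>'p\<close>.
  When proved with \<open>'n\<close> and \<open>'p\<close> left as type variables, it is flatness in the unrestricted
  sense.\<close>

definition flat_module ::
  "'n itself \<Rightarrow> 'p itself \<Rightarrow> ('a, 'b) ring_scheme \<Rightarrow> ('a, 'm) module \<Rightarrow> bool" where
  "flat_module _ _ R M \<longleftrightarrow> module R M \<and>
     (\<forall>(N :: ('a, 'n) module) (N' :: ('a, 'p) module) f.
        module R N \<longrightarrow> module R N' \<longrightarrow> f \<in> mod_hom R N N' \<longrightarrow> inj_on f (carrier N) \<longrightarrow>
        inj_on (tensor_map R M N N' f) (carrier (tensor_product R M N)))"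

text \<open>The ideal \<open>I\<close> with the action of \<open>R/(0:I)\<close> in which the coset of \<open>r\<close> acts as \<open>r\<close>.\<close>

definition ideal_mod_annihilator :: "('a, 'b) ring_scheme \<Rightarrow> 'a set \<Rightarrow> ('a set, 'a) module" where
  "ideal_mod_annihilator R I = \<lparr>carrier = I, monoid.mult = monoid.mult R, one = \<one>\<^bsub>R\<^esub>, ring.zero = \<zero>\<^bsub>R\<^esub>,
     add = add R, smult = (\<lambda>X x. THE y. \<exists>r\<in>X. y = r \<otimes>\<^bsub>R\<^esub> x)\<rparr>"


section \<open>Basic facts\<close>

lemma module_ideal_module:
  assumes "cring R" "ideal I R"
  shows "module R (ideal_module R I)"
proof -
  interpret cring R by fact
  interpret ideal I R by fact
  have c: "x \<in> I \<Longrightarrow> x \<in> carrier R" for x using a_subset by blast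
  have neg: "\<exists>y\<in>I. y \<oplus>\<^bsub>R\<^esub> x = \<zero>\<^bsub>R\<^esub>" if "x \<in> I" for x
    using that by (intro bexI[of _ "\<ominus>\<^bsub>R\<^esub> x"]) (auto simp: c l_neg)
  have neg': "\<exists>y\<in>I. x \<oplus>\<^bsub>R\<^esub> y = \<zero>\<^bsub>R\<^esub>" if "x \<in> I" for x
    using that by (intro bexI[of _ "\<ominus>\<^bsub>R\<^esub> x"]) (auto simp: c r_neg)
  show ?thesis
    by (intro moduleI abelian_groupI)
       (auto simp: ideal_module_def assms c neg neg' a_ac l_distr r_distr m_assoc I_l_closed)
qed

lemma module_direct_power:
  assumes "module R M"
  shows "module R (direct_power M n)"
proof -
  interpret module R M by fact
  have neg: "\<exists>y\<in>carrier (direct_power M n). y \<oplus>\<^bsub>direct_power M n\<^esub> x = \<zero>\<^bsub>direct_power M n\<^esub>"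
    if "x \<in> carrier (direct_power M n)" for x
    using that
    by (intro bexI[of _ "\<lambda>i\<in>{..<n}. \<ominus>\<^bsub>M\<^esub> x i"])
       (auto simp: direct_power_def PiE_iff M.l_neg intro!: restrict_ext)
  show ?thesis
    by (intro moduleI abelian_groupI neg)
       (auto simp: direct_power_def R.is_cring PiE_iff M.a_ac smult_l_distr smult_r_distr
          smult_assoc1 extensional_def fun_eq_iff)
qed

lemma mod_homD:
  assumes "f \<in> mod_hom R M N"
  shows "x \<in> carrier M \<Longrightarrow> f x \<in> carrier N"
    and "x \<in> carrier M \<Longrightarrow> y \<in> carrier M \<Longrightarrow> f (x \<oplus>\<^bsub>M\<^esub> y) = f x \<oplus>\<^bsub>N\<^esub> f y"
    and "r \<in> carrier R \<Longrightarrow> x \<in> carrier M \<Longrightarrow> f (r \<odot>\<^bsub>M\<^esub> x) = r \<odot>\<^bsub>N\<^esub> f x"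
  using assms by (auto simp: mod_hom_def hom_def)

lemma mod_homI:
  assumes "\<And>x. x \<in> carrier M \<Longrightarrow> f x \<in> carrier N"
    and "\<And>x y. x \<in> carrier M \<Longrightarrow> y \<in> carrier M \<Longrightarrow> f (x \<oplus>\<^bsub>M\<^esub> y) = f x \<oplus>\<^bsub>N\<^esub> f y"
    and "\<And>r x. r \<in> carrier R \<Longrightarrow> x \<in> carrier M \<Longrightarrow> f (r \<odot>\<^bsub>M\<^esub> x) = r \<odot>\<^bsub>N\<^esub> f x"
  shows "f \<in> mod_hom R M N"
  using assms by (auto simp: mod_hom_def hom_def)

lemma mod_hom_comp:
  assumes "f \<in> mod_hom R M N" "g \<in> mod_hom R N P"
  shows "(\<lambda>x. g (f x)) \<in> mod_hom R M P"
  by (rule mod_homI) (simp_all add: mod_homD[OF assms(1)] mod_homD[OF assms(2)])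


section \<open>The lifting property on arbitrary types\<close>

definition transport ::
  "('m \<Rightarrow> 'n) \<Rightarrow> ('n \<Rightarrow> 'm) \<Rightarrow> ('a, 'm) module \<Rightarrow> ('a, 'n) module" where
  "transport h k M = \<lparr>carrier = h ` carrier M, monoid.mult = (\<lambda>x y. h (k x \<otimes>\<^bsub>M\<^esub> k y)),
     one = h \<one>\<^bsub>M\<^esub>, ring.zero = h \<zero>\<^bsub>M\<^esub>, add = (\<lambda>x y. h (k x \<oplus>\<^bsub>M\<^esub> k y)),
     smult = (\<lambda>r x. h (r \<odot>\<^bsub>M\<^esub> k x))\<rparr>"

context
  fixes R :: "('a, 'b) ring_scheme" and M :: "('a, 'm) module" and h :: "'m \<Rightarrow> 'n" and k
  assumes M: "module R M" and kh: "\<And>x. x \<in> carrier M \<Longrightarrow> k (h x) = x"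
begin

interpretation module R M by (rule M)

lemma module_transport: "module R (transport h k M)"
proof -
  have neg: "\<exists>y\<in>carrier (transport h k M). y \<oplus>\<^bsub>transport h k M\<^esub> x = \<zero>\<^bsub>transport h k M\<^esub>"
    if "x \<in> carrier (transport h k M)" for x
    using that
    by (intro bexI[of _ "h (\<ominus>\<^bsub>M\<^esub> (k x))"]) (auto simp: transport_def kh M.l_neg)
  show ?thesis
    by (intro moduleI abelian_groupI neg)
       (auto simp: transport_def R.is_cring kh M.a_ac smult_l_distr smult_r_distr
          smult_assoc1)
qed

lemma transport_to: "h \<in> mod_hom R M (transport h k M)"
  by (rule mod_homI) (auto simp: transport_def kh)

lemma transport_from: "k \<in> mod_hom R (transport h k M) M"
  by (rule mod_homI) (auto simp: transport_def kh)

lemma finitely_presented_transport: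
  assumes "finitely_presented R M"
  shows "finitely_presented R (transport h k M)"
proof -
  obtain n e S where e: "e \<in> mod_hom R (direct_power (ideal_module R (carrier R)) n) M"
      "e ` carrier (direct_power (ideal_module R (carrier R)) n) = carrier M"
    and S: "finite S" "S \<subseteq> carrier (direct_power (ideal_module R (carrier R)) n)"
      "{x \<in> carrier (direct_power (ideal_module R (carrier R)) n). e x = \<zero>\<^bsub>M\<^esub>} =
        submodule_span R (direct_power (ideal_module R (carrier R)) n) S"
    using assms unfolding finitely_presented_def Let_def by (elim conjE exE bexE) (rule that)
  let ?F = "direct_power (ideal_module R (carrier R)) n"
  have "h (e x) = \<zero>\<^bsub>transport h k M\<^esub> \<longleftrightarrow> e x = \<zero>\<^bsub>M\<^esub>" if "x \<in> carrier ?F" for x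
  proof
    assume "h (e x) = \<zero>\<^bsub>transport h k M\<^esub>"
    then have "k (h (e x)) = k (h \<zero>\<^bsub>M\<^esub>)" by (simp add: transport_def)
    then show "e x = \<zero>\<^bsub>M\<^esub>"
      unfolding kh[OF mod_homD(1)[OF e(1) that]] kh[OF M.zero_closed] .
  qed (simp add: transport_def)
  then have "{x \<in> carrier ?F. h (e x) = \<zero>\<^bsub>transport h k M\<^esub>} = submodule_span R ?F S"
    unfolding S(3)[symmetric] by blast
  moreover have "(\<lambda>x. h (e x)) ` carrier ?F = carrier (transport h k M)"
    unfolding transport_def e(2)[symmetric] by auto
  ultimately show ?thesis
    unfolding finitely_presented_def Let_def
    by (intro conjI module_transport exI[of _ n] bexI[OF _ mod_hom_comp[OF e(1) transport_to]]
        exI[of _ S] S(1,2))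
qed

end

lemma rel_flatD:
  fixes R :: "('a, 'b) ring_scheme" and M :: "('a, 'm) module" and V :: "('a, 'v) module"
    and M' :: "('a, 'x) module" and G :: "('a, 'g) module"
  assumes flat: "rel_flat R M V"
    and M': "module R M'" and p: "p \<in> mod_hom R M M'" "p ` carrier M = carrier M'"
    and u: "u \<in> mod_hom R V M'" and G: "finitely_presented R G" and v: "v \<in> mod_hom R G V"
  shows "\<exists>q\<in>mod_hom R G M. \<forall>x\<in>carrier G. p (q x) = u (v x)"
proof -
  define h where "h y = {x \<in> carrier M. p x = y}" for y
  define k where "k X = p (SOME x. x \<in> X)" for X
  have kh: "k (h y) = y" if "y \<in> carrier M'" for y
  proof -
    have "\<exists>x. x \<in> h y" using that unfolding p(2)[symmetric] by (auto simp: h_def)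
    from someI_ex[OF this] show ?thesis by (simp add: h_def k_def)
  qed
  have GM: "module R G" using G by (simp add: finitely_presented_def)
  obtain n e where e: "e ` carrier (direct_power (ideal_module R (carrier R)) n) = carrier G"
    using G unfolding finitely_presented_def Let_def by (elim conjE exE bexE) (rule that)
  let ?F = "direct_power (ideal_module R (carrier R)) n"
  define h' where "h' y = {x \<in> carrier ?F. e x = y}" for y
  define k' where "k' X = e (SOME x. x \<in> X)" for X
  have kh': "k' (h' y) = y" if "y \<in> carrier G" for y
  proof -
    have "\<exists>x. x \<in> h' y" using that unfolding e[symmetric] by (auto simp: h'_def)
    from someI_ex[OF this] show ?thesis by (simp add: h'_def k'_def)
  qed
  let ?M = "transport h k M'" and ?G = "transport h' k' G"
  note to = transport_to[where h=h and k=k, OF M' kh] and to' = transport_to[where h=h' and k=k', OF GM kh']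
  note from' = transport_from[where h=h' and k=k', OF GM kh']
  have surj: "(\<lambda>x. h (p x)) ` carrier M = carrier ?M"
    unfolding transport_def p(2)[symmetric] by auto
  have "\<exists>q\<in>mod_hom R ?G M. \<forall>x\<in>carrier ?G. h (p (q x)) = h (u (v (k' x)))"
    using flat[unfolded rel_flat_def, THEN conjunct2, THEN conjunct2, rule_format,
      OF module_transport[where h=h and k=k, OF M' kh] mod_hom_comp[OF p(1) to] surj
        mod_hom_comp[OF u to] finitely_presented_transport[where h=h' and k=k', OF GM kh' G]
        mod_hom_comp[OF from' v]] .
  then obtain q where q: "q \<in> mod_hom R ?G M"
      "\<And>x. x \<in> carrier ?G \<Longrightarrow> h (p (q x)) = h (u (v (k' x)))"
    by (elim bexE) simp
  have "p (q (h' x)) = u (v x)" if x: "x \<in> carrier G" for x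
  proof -
    have x': "h' x \<in> carrier ?G" using x by (simp add: transport_def)
    have "h (p (q (h' x))) = h (u (v x))" using q(2)[OF x'] by (simp add: kh'[OF x])
    then have "k (h (p (q (h' x)))) = k (h (u (v x)))" by simp
    then show ?thesis
      using kh mod_homD(1)[OF p(1) mod_homD(1)[OF q(1) x']] mod_homD(1)[OF u mod_homD(1)[OF v x]]
      by simp
  qed
  then show ?thesis by (intro bexI[OF _ mod_hom_comp[OF to' q(1)]] ballI)
qed


section \<open>The induced map on tensor products\<close>

lemma keys_tensor_relators:
  assumes "module R M" "module R N" "c \<in> tensor_relators R M N"
  shows "Poly_Mapping.keys c \<subseteq> carrier M \<times> carrier N"
proof -
  interpret M: module R M by fact
  interpret N: module R N by fact
  have *: "Poly_Mapping.keys (a - b) \<subseteq> carrier M \<times> carrier N"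
    if "Poly_Mapping.keys a \<subseteq> carrier M \<times> carrier N" "Poly_Mapping.keys b \<subseteq> carrier M \<times> carrier N"
    for a b :: "_ \<Rightarrow>\<^sub>0 int"
    using keys_diff[of a b] that by blast
  from assms(3) show ?thesis
    unfolding tensor_relators_def
    by (elim UnE CollectE exE conjE; hypsubst; intro *; simp add: keys_frag_of)
qed

lemma tensor_kernel_normal:
  assumes "module R M" "module R N"
  shows "tensor_kernel R M N \<lhd> free_Abelian_group (carrier M \<times> carrier N)"
proof -
  interpret F: comm_group "free_Abelian_group (carrier M \<times> carrier N)"
    by (rule abelian_free_Abelian_group)
  have "tensor_relators R M N \<subseteq> carrier (free_Abelian_group (carrier M \<times> carrier N))"
    using keys_tensor_relators[OF assms] by auto
  then have "subgroup (tensor_kernel R M N) (free_Abelian_group (carrier M \<times> carrier N))"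
    unfolding tensor_kernel_def by (rule F.generate_is_subgroup)
  then show ?thesis by (rule F.subgroup_imp_normal)
qed

context
  fixes R :: "('a, 'b) ring_scheme" and M :: "('a, 'm) module" and N :: "('a, 'n) module"
    and N' :: "('a, 'p) module" and f
  assumes mods: "module R M" "module R N" "module R N'" and f: "f \<in> mod_hom R N N'"
begin

private abbreviation (input) "FN \<equiv> free_Abelian_group (carrier M \<times> carrier N)"
private abbreviation (input) "FN' \<equiv> free_Abelian_group (carrier M \<times> carrier N')"
private abbreviation (input) "\<phi> \<equiv> frag_extend (\<lambda>(x, y). frag_of (x, f y))"

interpretation FN: group FN by simp
interpretation FN': group FN' by simp
interpretation K: normal "tensor_kernel R M N" FN by (rule tensor_kernel_normal) (fact mods)+
interpretation K': normal "tensor_kernel R M N'" FN' by (rule tensor_kernel_normal) (fact mods)+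

lemma phi_hom: "\<phi> \<in> hom FN FN'"
proof (rule homI)
  fix c assume c: "c \<in> carrier FN"
  have "Poly_Mapping.keys (\<phi> c) \<subseteq> (\<Union>z\<in>Poly_Mapping.keys c. Poly_Mapping.keys (case z of (x, y) \<Rightarrow> frag_of (x, f y)))"
    by (rule keys_frag_extend)
  also have "\<dots> \<subseteq> carrier M \<times> carrier N'"
    using c mod_homD(1)[OF f] by (fastforce split: prod.splits simp: keys_frag_of)
  finally show "\<phi> c \<in> carrier FN'" by simp
qed (simp add: frag_extend_add)

lemma phi_kernel:
  assumes "c \<in> tensor_kernel R M N"
  shows "\<phi> c \<in> tensor_kernel R M N'"
proof -
  interpret P: group_hom FN FN' \<phi>
    by (rule group_hom.intro) (auto simp: group_hom_axioms_def phi_hom)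
  have rel: "\<phi> ` tensor_relators R M N \<subseteq> tensor_relators R M N'"
  proof (clarify)
    fix c assume "c \<in> tensor_relators R M N"
    then consider
      (1) x x' y where "c = frag_of (x \<oplus>\<^bsub>M\<^esub> x', y) - frag_of (x, y) - frag_of (x', y)"
        "x \<in> carrier M" "x' \<in> carrier M" "y \<in> carrier N"
    | (2) x y y' where "c = frag_of (x, y \<oplus>\<^bsub>N\<^esub> y') - frag_of (x, y) - frag_of (x, y')"
        "x \<in> carrier M" "y \<in> carrier N" "y' \<in> carrier N"
    | (3) r x y where "c = frag_of (r \<odot>\<^bsub>M\<^esub> x, y) - frag_of (x, r \<odot>\<^bsub>N\<^esub> y)"
        "r \<in> carrier R" "x \<in> carrier M" "y \<in> carrier N"
      unfolding tensor_relators_def by blast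
    then show "\<phi> c \<in> tensor_relators R M N'"
    proof cases
      case 1
      then have "\<phi> c = frag_of (x \<oplus>\<^bsub>M\<^esub> x', f y) - frag_of (x, f y) - frag_of (x', f y)"
        by (simp add: frag_extend_diff)
      then show ?thesis
        unfolding tensor_relators_def using 1 mod_homD(1)[OF f] by blast
    next
      case 2
      then have "\<phi> c = frag_of (x, f y \<oplus>\<^bsub>N'\<^esub> f y') - frag_of (x, f y) - frag_of (x, f y')"
        by (simp add: frag_extend_diff mod_homD(2)[OF f])
      then show ?thesis
        unfolding tensor_relators_def using 2 mod_homD(1)[OF f] by blast
    next
      case 3
      then have "\<phi> c = frag_of (r \<odot>\<^bsub>M\<^esub> x, f y) - frag_of (x, r \<odot>\<^bsub>N'\<^esub> f y)"
        by (simp add: frag_extend_diff mod_homD(3)[OF f])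
      then show ?thesis
        unfolding tensor_relators_def using 3 mod_homD(1)[OF f] by blast
    qed
  qed
  have sub: "tensor_relators R M N \<subseteq> carrier FN"
    using keys_tensor_relators[OF mods(1,2)] by auto
  have "\<phi> ` tensor_kernel R M N = generate FN' (\<phi> ` tensor_relators R M N)"
    unfolding tensor_kernel_def by (rule P.generate_img[OF sub, symmetric])
  also have "\<dots> \<subseteq> tensor_kernel R M N'"
    unfolding tensor_kernel_def by (rule FN'.mono_generate[OF rel])
  finally show ?thesis using assms by blast
qed

lemma tensor_map_coset:
  assumes c: "c \<in> carrier FN"
  shows "tensor_map R M N N' f (tensor_kernel R M N #>\<^bsub>FN\<^esub> c) = tensor_kernel R M N' #>\<^bsub>FN'\<^esub> \<phi> c"
proof -
  have "tensor_kernel R M N' #>\<^bsub>FN'\<^esub> \<phi> d = tensor_kernel R M N' #>\<^bsub>FN'\<^esub> \<phi> c"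
    if d: "d \<in> tensor_kernel R M N #>\<^bsub>FN\<^esub> c" for d
  proof -
    obtain a where a: "a \<in> tensor_kernel R M N" "d = a + c"
      using d by (auto simp: r_coset_def)
    have "\<phi> d \<in> tensor_kernel R M N' #>\<^bsub>FN'\<^esub> \<phi> c"
      using phi_kernel[OF a(1)] by (auto simp: a(2) frag_extend_add r_coset_def)
    then show ?thesis
      using FN'.repr_independence[OF _ hom_in_carrier[OF phi_hom c] K'.subgroup_axioms] by simp
  qed
  moreover have "c \<in> tensor_kernel R M N #>\<^bsub>FN\<^esub> c"
    by (rule FN.rcos_self[OF c K.subgroup_axioms])
  ultimately show ?thesis unfolding tensor_map_def by blast
qed

lemma tensor_map_elem:
  assumes "x \<in> carrier M" "y \<in> carrier N"
  shows "tensor_map R M N N' f (tensor_elem R M N x y) = tensor_elem R M N' x (f y)"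
  using tensor_map_coset[of "frag_of (x, y)"] assms by (simp add: tensor_elem_def keys_frag_of)

lemma tensor_map_hom: "tensor_map R M N N' f \<in> hom (tensor_product R M N) (tensor_product R M N')"
proof (rule homI)
  fix X assume "X \<in> carrier (tensor_product R M N)"
  then obtain c where "c \<in> carrier FN" "X = tensor_kernel R M N #>\<^bsub>FN\<^esub> c"
    by (auto simp: tensor_product_def FactGroup_def RCOSETS_def)
  then show "tensor_map R M N N' f X \<in> carrier (tensor_product R M N')"
    using hom_in_carrier[OF phi_hom]
    by (auto simp: tensor_map_coset tensor_product_def FactGroup_def RCOSETS_def)
next
  fix X Y assume "X \<in> carrier (tensor_product R M N)" "Y \<in> carrier (tensor_product R M N)"
  then obtain c d where c: "c \<in> carrier FN" "X = tensor_kernel R M N #>\<^bsub>FN\<^esub> c"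
    and d: "d \<in> carrier FN" "Y = tensor_kernel R M N #>\<^bsub>FN\<^esub> d"
    by (auto simp: tensor_product_def FactGroup_def RCOSETS_def)
  have cd: "c + d \<in> carrier FN" using FN.m_closed[OF c(1) d(1)] by simp
  have "X \<otimes>\<^bsub>tensor_product R M N\<^esub> Y = tensor_kernel R M N #>\<^bsub>FN\<^esub> (c + d)"
    using K.rcos_sum[OF c(1) d(1)] by (simp add: tensor_product_def FactGroup_def c(2) d(2))
  moreover have "(tensor_kernel R M N' #>\<^bsub>FN'\<^esub> \<phi> c) <#>\<^bsub>FN'\<^esub> (tensor_kernel R M N' #>\<^bsub>FN'\<^esub> \<phi> d)
      = tensor_kernel R M N' #>\<^bsub>FN'\<^esub> \<phi> (c + d)"
    using K'.rcos_sum[OF hom_in_carrier[OF phi_hom c(1)] hom_in_carrier[OF phi_hom d(1)]]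
    by (simp add: frag_extend_add)
  ultimately show "tensor_map R M N N' f (X \<otimes>\<^bsub>tensor_product R M N\<^esub> Y) =
      tensor_map R M N N' f X \<otimes>\<^bsub>tensor_product R M N'\<^esub> tensor_map R M N N' f Y"
    unfolding c(2) d(2)
    using tensor_map_coset[OF c(1)] tensor_map_coset[OF d(1)] tensor_map_coset[OF cd]
    by (simp add: tensor_product_def FactGroup_def)
qed

end


section \<open>An ideal as a module modulo its annihilator\<close>

context
  fixes R :: "('a, 'b) ring_scheme" and I
  assumes R: "cring R" and I: "ideal I R"
begin

interpretation cring R by (rule R)
interpretation I: ideal I R by (rule I)

lemma ideal_annihilator: "ideal (annihilator R I) R"
proof (rule idealI)
  show "ring R" by (rule ring_axioms)
  have c: "x \<in> I \<Longrightarrow> x \<in> carrier R" for x using I.a_subset by blast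
  show "subgroup (annihilator R I) (add_monoid R)"
    by (rule add.subgroupI)
       (auto simp: annihilator_def c l_distr l_minus simp flip: a_inv_def intro!: exI[of _ "\<zero>\<^bsub>R\<^esub>"])
  fix a x assume a: "a \<in> annihilator R I" and x: "x \<in> carrier R"
  then show "x \<otimes>\<^bsub>R\<^esub> a \<in> annihilator R I"
    by (auto simp: annihilator_def c m_assoc)
  then show "a \<otimes>\<^bsub>R\<^esub> x \<in> annihilator R I"
    using a x by (simp add: annihilator_def m_comm)
qed

lemma smult_ideal_mod_annihilator:
  assumes r: "r \<in> carrier R" and x: "x \<in> I"
  shows "(annihilator R I +>\<^bsub>R\<^esub> r) \<odot>\<^bsub>ideal_mod_annihilator R I\<^esub> x = r \<otimes>\<^bsub>R\<^esub> x"
proof -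
  interpret A: ideal "annihilator R I" R by (rule ideal_annihilator)
  have xc: "x \<in> carrier R" using x I.a_subset by blast
  have "s \<otimes>\<^bsub>R\<^esub> x = r \<otimes>\<^bsub>R\<^esub> x" if s: "s \<in> annihilator R I +>\<^bsub>R\<^esub> r" for s
  proof -
    obtain a where a: "a \<in> annihilator R I" and sa: "s = a \<oplus>\<^bsub>R\<^esub> r"
      using s unfolding a_r_coset_def' by blast
    have ac: "a \<in> carrier R" "a \<otimes>\<^bsub>R\<^esub> x = \<zero>\<^bsub>R\<^esub>"
      using a x unfolding annihilator_def by blast+
    show ?thesis unfolding sa by (simp add: l_distr ac r xc)
  qed
  moreover have "r \<in> annihilator R I +>\<^bsub>R\<^esub> r" by (rule A.a_rcos_self[OF r])
  ultimately have "(THE y. \<exists>s\<in>annihilator R I +>\<^bsub>R\<^esub> r. y = s \<otimes>\<^bsub>R\<^esub> x) = r \<otimes>\<^bsub>R\<^esub> x"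
    by (intro the_equality) blast+
  then show ?thesis by (simp add: ideal_mod_annihilator_def)
qed

lemma module_ideal_mod_annihilator:
  "module (R Quot annihilator R I) (ideal_mod_annihilator R I)"
proof -
  interpret A: ideal "annihilator R I" R by (rule ideal_annihilator)
  interpret J: module R "ideal_module R I" by (rule module_ideal_module[OF R I])
  let ?A = "annihilator R I" and ?M = "ideal_mod_annihilator R I"
  have rep: "\<exists>r\<in>carrier R. X = ?A +>\<^bsub>R\<^esub> r" if "X \<in> carrier (R Quot ?A)" for X
    using that by (auto simp: FactRing_def A_RCOSETS_def')
  have c: "x \<in> I \<Longrightarrow> x \<in> carrier R" for x using I.a_subset by blast
  have neg: "\<exists>y\<in>I. y \<oplus>\<^bsub>R\<^esub> x = \<zero>\<^bsub>R\<^esub>" if "x \<in> I" for x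
    using that by (intro bexI[of _ "\<ominus>\<^bsub>R\<^esub> x"]) (auto simp: c l_neg)
  have carr: "carrier ?M = I" "add ?M = add R" by (simp_all add: ideal_mod_annihilator_def)
  note s = smult_ideal_mod_annihilator
  show ?thesis
  proof (rule moduleI)
    show "cring (R Quot ?A)" by (rule A.quotient_is_cring[OF R])
    show "abelian_group ?M"
      using J.M.a_closed J.M.zero_closed J.M.a_assoc J.M.a_comm J.M.l_zero neg
      by (intro abelian_groupI) (simp_all add: ideal_module_def ideal_mod_annihilator_def)
  next
    fix X x assume "X \<in> carrier (R Quot ?A)" "x \<in> carrier ?M"
    then show "X \<odot>\<^bsub>?M\<^esub> x \<in> carrier ?M"
      using rep[of X] by (auto simp: carr s I.I_l_closed)
  next
    fix X Y x assume "X \<in> carrier (R Quot ?A)" "Y \<in> carrier (R Quot ?A)" "x \<in> carrier ?M"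
    then obtain a b where "a \<in> carrier R" "X = ?A +>\<^bsub>R\<^esub> a" "b \<in> carrier R" "Y = ?A +>\<^bsub>R\<^esub> b" "x \<in> I"
      using rep carr by metis
    then show "(X \<oplus>\<^bsub>R Quot ?A\<^esub> Y) \<odot>\<^bsub>?M\<^esub> x = X \<odot>\<^bsub>?M\<^esub> x \<oplus>\<^bsub>?M\<^esub> Y \<odot>\<^bsub>?M\<^esub> x"
      and "(X \<otimes>\<^bsub>R Quot ?A\<^esub> Y) \<odot>\<^bsub>?M\<^esub> x = X \<odot>\<^bsub>?M\<^esub> (Y \<odot>\<^bsub>?M\<^esub> x)"
      by (simp_all add: FactRing_def A.a_rcos_sum A.rcoset_mult_add s carr c l_distr m_assoc I.I_l_closed)
  next
    fix X x y assume "X \<in> carrier (R Quot ?A)" "x \<in> carrier ?M" "y \<in> carrier ?M"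
    then obtain a where "a \<in> carrier R" "X = ?A +>\<^bsub>R\<^esub> a" "x \<in> I" "y \<in> I"
      using rep carr by metis
    then show "X \<odot>\<^bsub>?M\<^esub> (x \<oplus>\<^bsub>?M\<^esub> y) = X \<odot>\<^bsub>?M\<^esub> x \<oplus>\<^bsub>?M\<^esub> X \<odot>\<^bsub>?M\<^esub> y"
      by (simp add: s carr c r_distr)
  next
    fix x assume "x \<in> carrier ?M"
    then show "\<one>\<^bsub>R Quot ?A\<^esub> \<odot>\<^bsub>?M\<^esub> x = x"
      by (simp add: FactRing_def s carr c)
  qed
qed

end

end

theory Submission
  imports Defs
begin

text \<open>
  Write \<open>(x)\<close> for the ideal generated by \<open>x\<close> and \<open>(0:x)\<close> for its annihilator, and call \<open>a\<close>, \<open>b\<close>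
  incomparable if neither of \<open>(a)\<close>, \<open>(b)\<close> contains the other; a ring that is not a chain ring
  has such a pair. Quasi-flatness of \<open>(a) + (b)\<close> then forces \<open>(a) \<inter> (b) = 0\<close> and \<open>(0:a) = (0:b)\<close>
  (\<open>incomparable_inter\<close>, \<open>incomparable_kills\<close>): relations between \<open>a\<close> and \<open>b\<close> can be lifted along
  \<open>V \<rightarrow> V/W\<close>, where \<open>V = (a) + (b)\<close>, for suitable maps \<open>V \<rightarrow> V/W\<close>, and because
  \<open>R\<close> is local, each lifted relation says that a unit annihilates the element that should vanish.

  Fix an incomparable pair \<open>a\<close>, \<open>b\<close>. Comparing an arbitrary element with \<open>a\<close> and \<open>b\<close> shows that there are
  only three annihilators of elements: \<open>R\<close>, \<open>(0:a)\<close> and \<open>0\<close> (\<open>annihilator_trichotomy\<close>). So an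
  ideal \<open>I\<close> is of one of two kinds.

  If \<open>I\<close> contains a regular element, then \<open>(0:I) = 0\<close>. A regular element is comparable with every
  element, hence every finite subset of \<open>I\<close> lies in a principal ideal that is generated by a regular
  element of \<open>I\<close>, that is, in a free submodule (\<open>regular_finite_subset_principal\<close>).

  If \<open>I\<close> contains no regular element, then all its nonzero elements have annihilator \<open>(0:I)\<close>, so \<open>I\<close> is
  torsion-free over \<open>R/(0:I)\<close>, and any two elements of \<open>R/(0:I)\<close> are comparable under divisibility
  (\<open>torsion_free_mod_annihilator\<close>). A minimal finite generating set of a submodule is then independent,
  so again every finite subset of \<open>I\<close> lies in a free submodule (\<open>torsion_free_flat\<close>).

  In both cases \<open>I\<close> is flat by \<open>flat_module_if_locally_free\<close>: an equation in a tensor product with \<open>I\<close>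
  holds already in the tensor product with a finitely generated submodule, which may be taken free,
  and there it can be read off from coordinates.
\<close>

section \<open>Nonunits of a local ring\<close>

text \<open>Krull's theorem, by Zorn's lemma: a union of a chain of ideals that avoid \<open>\<one>\<close> avoids \<open>\<one>\<close>.\<close>

lemma (in cring) exists_maximalideal:
  assumes "ideal I R" "I \<noteq> carrier R"
  shows "\<exists>m. maximalideal m R \<and> I \<subseteq> m"
proof -
  let ?S = "{J. ideal J R \<and> I \<subseteq> J \<and> \<one> \<notin> J}"
  have one: "\<one> \<in> J \<Longrightarrow> J = carrier R" if "ideal J R" for J
    using ideal.one_imp_carrier[OF that] .
  have "\<exists>M\<in>?S. \<forall>X\<in>?S. M \<subseteq> X \<longrightarrow> X = M"
  proof (rule subset_Zorn_nonempty)
    show "?S \<noteq> {}" using assms one by blast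
    fix C assume C: "C \<noteq> {}" "subset.chain ?S C"
    then have id: "ideal J R" if "J \<in> C" for J
      using that unfolding subset.chain_def by blast
    have cmp: "J \<subseteq> K \<or> K \<subseteq> J" if "J \<in> C" "K \<in> C" for J K
      using that C(2) unfolding subset.chain_def by blast
    have "ideal (\<Union>C) R"
    proof (rule idealI[OF ring_axioms])
      show "subgroup (\<Union>C) (add_monoid R)"
      proof (rule add.subgroupI)
        show "\<Union>C \<subseteq> carrier R" using ideal.Icarr[OF id] by blast
        show "\<Union>C \<noteq> {}"
          using C(1) additive_subgroup.zero_closed[OF ideal.axioms(1)[OF id]] by blast
        show "\<ominus> x \<in> \<Union>C" if "x \<in> \<Union>C" for x
          using that additive_subgroup.a_inv_closed[OF ideal.axioms(1)[OF id]] by blast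
        show "x \<oplus> y \<in> \<Union>C" if "x \<in> \<Union>C" "y \<in> \<Union>C" for x y
          using that cmp additive_subgroup.a_closed[OF ideal.axioms(1)[OF id]] by blast
      qed
    qed (use ideal.I_l_closed[OF id] ideal.I_r_closed[OF id] in blast)+
    then show "\<Union>C \<in> ?S" using C unfolding subset.chain_def by blast
  qed
  then obtain m where m: "m \<in> ?S" and max: "\<forall>X\<in>?S. m \<subseteq> X \<longrightarrow> X = m" ..
  have m': "ideal m R" "I \<subseteq> m" "\<one> \<notin> m" using m by auto
  have "maximalideal m R"
  proof (rule maximalidealI)
    fix J assume J: "ideal J R" "m \<subseteq> J" "J \<subseteq> carrier R"
    show "J = m \<or> J = carrier R"
    proof (cases "\<one> \<in> J")
      case False
      then have "J \<in> ?S" using J m' by simp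
      then show ?thesis using max J(2) by simp
    qed (use one[OF J(1)] in simp)
  qed (use m' in auto)
  then show ?thesis using m' by blast
qed

locale local_fqf_ring = cring +
  assumes local: "local_ring R" and fqf: "fqf_ring R"

context local_fqf_ring
begin

text \<open>Every nonunit generates a proper ideal, hence lies in the unique maximal ideal.\<close>

lemma nonunits_add:
  assumes x: "x \<in> carrier R" "x \<notin> Units R" and y: "y \<in> carrier R" "y \<notin> Units R"
  shows "x \<oplus> y \<notin> Units R"
proof
  assume "x \<oplus> y \<in> Units R"
  obtain m where m: "maximalideal m R" "\<And>m'. maximalideal m' R \<Longrightarrow> m' = m"
    using local unfolding local_ring_def by blast
  interpret m: maximalideal m R by (rule m)
  have "z \<in> m" if z: "z \<in> carrier R" "z \<notin> Units R" for z
  proof -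
    have "\<one> \<notin> PIdl z"
      using z unfolding cgenideal_def Units_def by (auto simp: m_comm)
    then have "PIdl z \<noteq> carrier R" by auto
    from exists_maximalideal[OF cgenideal_ideal[OF z(1)] this] m(2) cgenideal_self[OF z(1)]
    show ?thesis by blast
  qed
  then have "x \<oplus> y \<in> m" using x y by blast
  then have "inv (x \<oplus> y) \<otimes> (x \<oplus> y) \<in> m"
    using \<open>x \<oplus> y \<in> Units R\<close> by (intro m.I_l_closed) auto
  then have "\<one> \<in> m" using Units_l_inv[OF \<open>x \<oplus> y \<in> Units R\<close>] by simp
  then show False using m.one_imp_carrier m.I_notcarr by blast
qed

lemma one_add_nonunit:
  assumes c: "c \<in> carrier R" "c \<notin> Units R"
  shows "\<one> \<oplus> c \<in> Units R"
proof (rule ccontr)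
  assume *: "\<one> \<oplus> c \<notin> Units R"
  have "\<ominus> c \<notin> Units R"
  proof
    assume "\<ominus> c \<in> Units R"
    then obtain d where "d \<in> carrier R" "d \<otimes> \<ominus> c = \<one>" unfolding Units_def by blast
    then have "(\<ominus> d) \<otimes> c = \<one>" "\<ominus> d \<in> carrier R" using c by (simp_all add: l_minus r_minus)
    then have "c \<in> Units R" using c unfolding Units_def by (auto simp: m_comm intro!: bexI[of _ "\<ominus> d"])
    with c show False by simp
  qed
  then have "(\<one> \<oplus> c) \<oplus> \<ominus> c \<notin> Units R" using nonunits_add[of "\<one> \<oplus> c" "\<ominus> c"] c * by simp
  moreover have "(\<one> \<oplus> c) \<oplus> \<ominus> c = \<one>" using c by (simp add: a_assoc r_neg)
  ultimately show False using Units_one_closed by metis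
qed

lemma unit_cancel:
  assumes "u \<in> Units R" "x \<in> carrier R" "u \<otimes> x = \<zero>"
  shows "x = \<zero>"
proof -
  have "x = (inv u \<otimes> u) \<otimes> x" using assms by simp
  also have "\<dots> = inv u \<otimes> (u \<otimes> x)" using assms by (intro m_assoc) auto
  finally show ?thesis using assms by simp
qed

text \<open>Contrapositively: if \<open>a\<close> is not in \<open>(b)\<close> but \<open>u \<otimes> a\<close> is, then \<open>u\<close> is a nonunit. This is how locality
  enters for incomparable elements.\<close>

lemma unit_multiple:
  assumes "u \<in> Units R" "a \<in> carrier R" "b \<in> carrier R" "u \<otimes> a \<in> PIdl b"
  shows "a \<in> PIdl b"
proof -
  have "a = (inv u \<otimes> u) \<otimes> a" using assms by simp
  also have "\<dots> = inv u \<otimes> (u \<otimes> a)" using assms by (intro m_assoc) auto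
  finally show ?thesis
    using ideal.I_l_closed[OF cgenideal_ideal[OF assms(3)] assms(4), of "inv u"] assms by simp
qed

end


section \<open>Quotient modules and modules on two generators\<close>

text \<open>The action is a union over representatives, all of which give the same coset
  (\<open>smult_quotient_module\<close>).\<close>

definition quotient_module :: "('a, 'm) module \<Rightarrow> 'm set \<Rightarrow> ('a, 'm set) module" where
  "quotient_module M K = \<lparr>carrier = a_rcosets\<^bsub>M\<^esub> K, monoid.mult = (\<lambda>X Y. K), one = K,
     ring.zero = K, add = set_add M, smult = (\<lambda>r X. \<Union>x\<in>X. K +>\<^bsub>M\<^esub> (r \<odot>\<^bsub>M\<^esub> x))\<rparr>"

context
  fixes R :: "('a, 'b) ring_scheme" and M :: "('a, 'm) module" and K
  assumes M: "module R M" and K: "submodule K R M"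
begin

interpretation module R M by (rule M)
interpretation K: abelian_subgroup K M
  using abelian_subgroupI2[OF M.a_comm_group] submodule.axioms(1)[OF K] by blast

lemma coset_eq_iff:
  assumes "x \<in> carrier M" "y \<in> carrier M"
  shows "K +>\<^bsub>M\<^esub> x = K +>\<^bsub>M\<^esub> y \<longleftrightarrow> x \<ominus>\<^bsub>M\<^esub> y \<in> K"
proof
  assume "K +>\<^bsub>M\<^esub> x = K +>\<^bsub>M\<^esub> y"
  then have "x \<in> K +>\<^bsub>M\<^esub> y" using K.a_rcos_self[OF assms(1)] by simp
  then obtain k where k: "k \<in> K" "k \<in> carrier M" "x = k \<oplus>\<^bsub>M\<^esub> y"
    using K.a_subset unfolding a_r_coset_def' by blast
  then have "x \<ominus>\<^bsub>M\<^esub> y = k"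
    using assms by (simp add: a_minus_def M.a_assoc M.r_neg)
  then show "x \<ominus>\<^bsub>M\<^esub> y \<in> K" using k by simp
next
  assume "x \<ominus>\<^bsub>M\<^esub> y \<in> K"
  then have "(x \<ominus>\<^bsub>M\<^esub> y) \<oplus>\<^bsub>M\<^esub> y \<in> K +>\<^bsub>M\<^esub> y" unfolding a_r_coset_def' by blast
  moreover have "(x \<ominus>\<^bsub>M\<^esub> y) \<oplus>\<^bsub>M\<^esub> y = x"
    using assms by (simp add: a_minus_def M.a_assoc M.l_neg)
  ultimately show "K +>\<^bsub>M\<^esub> x = K +>\<^bsub>M\<^esub> y"
    using M.a_repr_independence[OF _ assms(2) K.a_subgroup] by simp
qed

lemma smult_quotient_module:
  assumes r: "r \<in> carrier R" and x: "x \<in> carrier M"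
  shows "r \<odot>\<^bsub>quotient_module M K\<^esub> (K +>\<^bsub>M\<^esub> x) = K +>\<^bsub>M\<^esub> (r \<odot>\<^bsub>M\<^esub> x)"
proof -
  have "K +>\<^bsub>M\<^esub> (r \<odot>\<^bsub>M\<^esub> y) = K +>\<^bsub>M\<^esub> (r \<odot>\<^bsub>M\<^esub> x)" if "y \<in> K +>\<^bsub>M\<^esub> x" for y
  proof -
    from that obtain k where k: "k \<in> K" and y: "y = k \<oplus>\<^bsub>M\<^esub> x"
      unfolding a_r_coset_def' by blast
    have kc: "k \<in> carrier M" using k K.a_subset by blast
    have "r \<odot>\<^bsub>M\<^esub> y \<ominus>\<^bsub>M\<^esub> r \<odot>\<^bsub>M\<^esub> x = r \<odot>\<^bsub>M\<^esub> k"
      using r x kc by (simp add: y smult_r_distr a_minus_def M.a_assoc M.r_neg)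
    then show ?thesis
      using coset_eq_iff[of "r \<odot>\<^bsub>M\<^esub> y" "r \<odot>\<^bsub>M\<^esub> x"] submodule.smult_closed[OF K r k] kc r x
      by (simp add: y)
  qed
  then have "(\<Union>y\<in>K +>\<^bsub>M\<^esub> x. K +>\<^bsub>M\<^esub> (r \<odot>\<^bsub>M\<^esub> y)) = (\<Union>y\<in>K +>\<^bsub>M\<^esub> x. K +>\<^bsub>M\<^esub> (r \<odot>\<^bsub>M\<^esub> x))"
    by (intro SUP_cong refl)
  also have "\<dots> = K +>\<^bsub>M\<^esub> (r \<odot>\<^bsub>M\<^esub> x)"
    using K.a_rcos_self[OF x] by (subst UN_constant) auto
  finally show ?thesis by (simp add: quotient_module_def)
qed

lemma module_quotient_module: "module R (quotient_module M K)"
proof -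
  have rep: "\<exists>x\<in>carrier M. X = K +>\<^bsub>M\<^esub> x" if "X \<in> carrier (quotient_module M K)" for X
    using that by (auto simp: quotient_module_def A_RCOSETS_def')
  have add: "(K +>\<^bsub>M\<^esub> x) \<oplus>\<^bsub>quotient_module M K\<^esub> (K +>\<^bsub>M\<^esub> y) = K +>\<^bsub>M\<^esub> (x \<oplus>\<^bsub>M\<^esub> y)"
    if "x \<in> carrier M" "y \<in> carrier M" for x y
    using that by (simp add: quotient_module_def K.a_rcos_sum)
  have [simp]: "K +>\<^bsub>M\<^esub> x \<in> carrier (quotient_module M K)" if "x \<in> carrier M" for x
    using that by (auto simp: quotient_module_def A_RCOSETS_def')
  have zero: "\<zero>\<^bsub>quotient_module M K\<^esub> = K +>\<^bsub>M\<^esub> \<zero>\<^bsub>M\<^esub>"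
    using K.a_subset by (simp add: quotient_module_def)
  note simps = add smult_quotient_module
  show ?thesis
  proof (rule moduleI)
    show "abelian_group (quotient_module M K)"
    proof (rule abelian_groupI)
      fix X assume "X \<in> carrier (quotient_module M K)"
      then obtain x where x: "x \<in> carrier M" "X = K +>\<^bsub>M\<^esub> x" using rep by blast
      then show "\<exists>Y\<in>carrier (quotient_module M K). Y \<oplus>\<^bsub>quotient_module M K\<^esub> X = \<zero>\<^bsub>quotient_module M K\<^esub>"
        by (intro bexI[of _ "K +>\<^bsub>M\<^esub> (\<ominus>\<^bsub>M\<^esub> x)"]) (auto simp: add M.l_neg zero)
    qed (use rep in \<open>auto simp: add M.a_ac zero dest!: rep\<close>)
  next
    fix a X assume "a \<in> carrier R" "X \<in> carrier (quotient_module M K)"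
    then show "a \<odot>\<^bsub>quotient_module M K\<^esub> X \<in> carrier (quotient_module M K)"
      using rep[of X] by (auto simp: simps)
  next
    fix a b X assume "a \<in> carrier R" "b \<in> carrier R" "X \<in> carrier (quotient_module M K)"
    then show "(a \<oplus>\<^bsub>R\<^esub> b) \<odot>\<^bsub>quotient_module M K\<^esub> X =
        a \<odot>\<^bsub>quotient_module M K\<^esub> X \<oplus>\<^bsub>quotient_module M K\<^esub> b \<odot>\<^bsub>quotient_module M K\<^esub> X"
      and "(a \<otimes>\<^bsub>R\<^esub> b) \<odot>\<^bsub>quotient_module M K\<^esub> X =
        a \<odot>\<^bsub>quotient_module M K\<^esub> (b \<odot>\<^bsub>quotient_module M K\<^esub> X)"
      using rep[of X] by (auto simp: simps smult_l_distr smult_assoc1)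
  next
    fix a X Y
    assume "a \<in> carrier R" "X \<in> carrier (quotient_module M K)" "Y \<in> carrier (quotient_module M K)"
    then show "a \<odot>\<^bsub>quotient_module M K\<^esub> (X \<oplus>\<^bsub>quotient_module M K\<^esub> Y) =
        a \<odot>\<^bsub>quotient_module M K\<^esub> X \<oplus>\<^bsub>quotient_module M K\<^esub> a \<odot>\<^bsub>quotient_module M K\<^esub> Y"
      using rep[of X] rep[of Y] by (auto simp: simps smult_r_distr)
  next
    fix X assume "X \<in> carrier (quotient_module M K)"
    then show "\<one>\<^bsub>R\<^esub> \<odot>\<^bsub>quotient_module M K\<^esub> X = X"
      using rep[of X] by (auto simp: simps)
  qed (rule R.is_cring)
qed

lemma coset_mod_hom: "(\<lambda>x. K +>\<^bsub>M\<^esub> x) \<in> mod_hom R M (quotient_module M K)"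
proof (rule mod_homI)
  show "K +>\<^bsub>M\<^esub> x \<in> carrier (quotient_module M K)" if "x \<in> carrier M" for x
    using M.a_rcosetsI[OF K.a_subset that] by (simp add: quotient_module_def)
  show "K +>\<^bsub>M\<^esub> (x \<oplus>\<^bsub>M\<^esub> y) =
      (K +>\<^bsub>M\<^esub> x) \<oplus>\<^bsub>quotient_module M K\<^esub> (K +>\<^bsub>M\<^esub> y)"
    if "x \<in> carrier M" "y \<in> carrier M" for x y
    using K.a_rcos_sum[OF that] by (simp add: quotient_module_def)
  show "K +>\<^bsub>M\<^esub> (r \<odot>\<^bsub>M\<^esub> x) = r \<odot>\<^bsub>quotient_module M K\<^esub> (K +>\<^bsub>M\<^esub> x)"
    if "r \<in> carrier R" "x \<in> carrier M" for r x
    by (rule smult_quotient_module[OF that, symmetric])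
qed

lemma coset_surj: "(\<lambda>x. K +>\<^bsub>M\<^esub> x) ` carrier M = carrier (quotient_module M K)"
  by (simp add: quotient_module_def A_RCOSETS_def' UNION_singleton_eq_range)

lemma coset_eq_zero_iff:
  assumes "x \<in> carrier M"
  shows "K +>\<^bsub>M\<^esub> x = \<zero>\<^bsub>quotient_module M K\<^esub> \<longleftrightarrow> x \<in> K"
proof -
  have "K +>\<^bsub>M\<^esub> x = K \<longleftrightarrow> x \<in> K"
  proof
    show "x \<in> K" if "K +>\<^bsub>M\<^esub> x = K" by (rule M.a_coset_join1[OF that assms K.a_subgroup])
    show "K +>\<^bsub>M\<^esub> x = K" if "x \<in> K" by (rule M.a_coset_join2[OF assms K.a_subgroup that])
  qed
  then show ?thesis by (simp add: quotient_module_def)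
qed

end

lemma submodule_span_submodule:
  assumes "module R M" "S \<subseteq> carrier M"
  shows "submodule (submodule_span R M S) R M"
proof -
  interpret module R M by fact
  show ?thesis
  proof (rule submoduleI)
    show "submodule_span R M S \<subseteq> carrier M"
      unfolding submodule_span_def using carrier_is_submodule assms(2) by blast
    show "\<zero>\<^bsub>M\<^esub> \<in> submodule_span R M S"
      unfolding submodule_span_def
      using subgroup.one_closed[OF submodule.axioms(1)] by fastforce
  qed (auto simp: submodule_span_def submoduleE)
qed

lemma finitely_presented_quotient:
  fixes R :: "('a, 'b) ring_scheme"
  defines "F \<equiv> direct_power (ideal_module R (carrier R))"
  assumes "cring R" "finite S" "S \<subseteq> carrier (F n)"
  shows "finitely_presented R (quotient_module (F n) (submodule_span R (F n) S))"
proof -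
  interpret cring R by fact
  have F: "module R (F n)"
    unfolding F_def by (intro module_direct_power module_ideal_module oneideal assms(2))
  note K = submodule_span_submodule[OF F assms(4)]
  show ?thesis
    unfolding finitely_presented_def Let_def F_def[symmetric]
    using coset_eq_zero_iff[OF F K] subgroup.subset[OF submodule.axioms(1)[OF K]] assms(3,4)
    by (intro conjI module_quotient_module[OF F K] exI[of _ n] bexI[OF _ coset_mod_hom[OF F K]]
        coset_surj[OF F K] exI[of _ S]) auto
qed

lemma mod_hom_zero:
  assumes "module R M" "module R N" "f \<in> mod_hom R M N"
  shows "f \<zero>\<^bsub>M\<^esub> = \<zero>\<^bsub>N\<^esub>"
proof -
  interpret M: module R M by fact
  interpret N: module R N by fact
  have "f (\<zero>\<^bsub>R\<^esub> \<odot>\<^bsub>M\<^esub> \<zero>\<^bsub>M\<^esub>) = \<zero>\<^bsub>R\<^esub> \<odot>\<^bsub>N\<^esub> f \<zero>\<^bsub>M\<^esub>" by (rule mod_homD[OF assms(3)]) auto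
  then show ?thesis using mod_homD(1)[OF assms(3)] by simp
qed

lemma two_generated_hom:
  assumes "module R M" "module R N"
    and m: "m\<^sub>1 \<in> carrier M" "m\<^sub>2 \<in> carrier M" and n: "n\<^sub>1 \<in> carrier N" "n\<^sub>2 \<in> carrier N"
    and gen: "\<And>x. x \<in> carrier M \<Longrightarrow>
      \<exists>r\<in>carrier R. \<exists>s\<in>carrier R. x = r \<odot>\<^bsub>M\<^esub> m\<^sub>1 \<oplus>\<^bsub>M\<^esub> s \<odot>\<^bsub>M\<^esub> m\<^sub>2"
    and rel: "\<And>r s. r \<in> carrier R \<Longrightarrow> s \<in> carrier R \<Longrightarrow>
      r \<odot>\<^bsub>M\<^esub> m\<^sub>1 \<oplus>\<^bsub>M\<^esub> s \<odot>\<^bsub>M\<^esub> m\<^sub>2 = \<zero>\<^bsub>M\<^esub> \<Longrightarrow> r \<odot>\<^bsub>N\<^esub> n\<^sub>1 \<oplus>\<^bsub>N\<^esub> s \<odot>\<^bsub>N\<^esub> n\<^sub>2 = \<zero>\<^bsub>N\<^esub>"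
  shows "\<exists>f\<in>mod_hom R M N. f m\<^sub>1 = n\<^sub>1 \<and> f m\<^sub>2 = n\<^sub>2"
proof -
  interpret M: module R M by fact
  interpret N: module R N by fact
  have diff_M: "(r \<ominus>\<^bsub>R\<^esub> r') \<odot>\<^bsub>M\<^esub> m\<^sub>1 \<oplus>\<^bsub>M\<^esub> (s \<ominus>\<^bsub>R\<^esub> s') \<odot>\<^bsub>M\<^esub> m\<^sub>2 =
      (r \<odot>\<^bsub>M\<^esub> m\<^sub>1 \<oplus>\<^bsub>M\<^esub> s \<odot>\<^bsub>M\<^esub> m\<^sub>2) \<ominus>\<^bsub>M\<^esub> (r' \<odot>\<^bsub>M\<^esub> m\<^sub>1 \<oplus>\<^bsub>M\<^esub> s' \<odot>\<^bsub>M\<^esub> m\<^sub>2)"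
    if "r \<in> carrier R" "s \<in> carrier R" "r' \<in> carrier R" "s' \<in> carrier R" for r s r' s'
    using that m by (simp add: M.minus_eq M.R.minus_eq M.smult_l_distr M.smult_l_minus M.M.minus_add M.M.a_ac)
  have diff_N: "(r \<ominus>\<^bsub>R\<^esub> r') \<odot>\<^bsub>N\<^esub> n\<^sub>1 \<oplus>\<^bsub>N\<^esub> (s \<ominus>\<^bsub>R\<^esub> s') \<odot>\<^bsub>N\<^esub> n\<^sub>2 =
      (r \<odot>\<^bsub>N\<^esub> n\<^sub>1 \<oplus>\<^bsub>N\<^esub> s \<odot>\<^bsub>N\<^esub> n\<^sub>2) \<ominus>\<^bsub>N\<^esub> (r' \<odot>\<^bsub>N\<^esub> n\<^sub>1 \<oplus>\<^bsub>N\<^esub> s' \<odot>\<^bsub>N\<^esub> n\<^sub>2)"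
    if "r \<in> carrier R" "s \<in> carrier R" "r' \<in> carrier R" "s' \<in> carrier R" for r s r' s'
    using that n by (simp add: N.minus_eq M.R.minus_eq N.smult_l_distr N.smult_l_minus N.M.minus_add N.M.a_ac)
  define f where "f x = (THE y. \<exists>r\<in>carrier R. \<exists>s\<in>carrier R.
      x = r \<odot>\<^bsub>M\<^esub> m\<^sub>1 \<oplus>\<^bsub>M\<^esub> s \<odot>\<^bsub>M\<^esub> m\<^sub>2 \<and> y = r \<odot>\<^bsub>N\<^esub> n\<^sub>1 \<oplus>\<^bsub>N\<^esub> s \<odot>\<^bsub>N\<^esub> n\<^sub>2)" for x
  have f: "f (r \<odot>\<^bsub>M\<^esub> m\<^sub>1 \<oplus>\<^bsub>M\<^esub> s \<odot>\<^bsub>M\<^esub> m\<^sub>2) = r \<odot>\<^bsub>N\<^esub> n\<^sub>1 \<oplus>\<^bsub>N\<^esub> s \<odot>\<^bsub>N\<^esub> n\<^sub>2"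
    if rs: "r \<in> carrier R" "s \<in> carrier R" for r s
    unfolding f_def
  proof (rule the_equality)
    fix y assume "\<exists>r'\<in>carrier R. \<exists>s'\<in>carrier R.
      r \<odot>\<^bsub>M\<^esub> m\<^sub>1 \<oplus>\<^bsub>M\<^esub> s \<odot>\<^bsub>M\<^esub> m\<^sub>2 = r' \<odot>\<^bsub>M\<^esub> m\<^sub>1 \<oplus>\<^bsub>M\<^esub> s' \<odot>\<^bsub>M\<^esub> m\<^sub>2 \<and> y = r' \<odot>\<^bsub>N\<^esub> n\<^sub>1 \<oplus>\<^bsub>N\<^esub> s' \<odot>\<^bsub>N\<^esub> n\<^sub>2"
    then obtain r' s' where rs': "r' \<in> carrier R" "s' \<in> carrier R" "y = r' \<odot>\<^bsub>N\<^esub> n\<^sub>1 \<oplus>\<^bsub>N\<^esub> s' \<odot>\<^bsub>N\<^esub> n\<^sub>2"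
      and eq: "r \<odot>\<^bsub>M\<^esub> m\<^sub>1 \<oplus>\<^bsub>M\<^esub> s \<odot>\<^bsub>M\<^esub> m\<^sub>2 = r' \<odot>\<^bsub>M\<^esub> m\<^sub>1 \<oplus>\<^bsub>M\<^esub> s' \<odot>\<^bsub>M\<^esub> m\<^sub>2" by blast
    have "(r \<ominus>\<^bsub>R\<^esub> r') \<odot>\<^bsub>M\<^esub> m\<^sub>1 \<oplus>\<^bsub>M\<^esub> (s \<ominus>\<^bsub>R\<^esub> s') \<odot>\<^bsub>M\<^esub> m\<^sub>2 = \<zero>\<^bsub>M\<^esub>"
      unfolding diff_M[OF rs rs'(1,2)] eq using rs' m by (simp add: M.M.minus_eq M.M.r_neg)
    then have "(r \<odot>\<^bsub>N\<^esub> n\<^sub>1 \<oplus>\<^bsub>N\<^esub> s \<odot>\<^bsub>N\<^esub> n\<^sub>2) \<ominus>\<^bsub>N\<^esub> (r' \<odot>\<^bsub>N\<^esub> n\<^sub>1 \<oplus>\<^bsub>N\<^esub> s' \<odot>\<^bsub>N\<^esub> n\<^sub>2) = \<zero>\<^bsub>N\<^esub>"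
      unfolding diff_N[OF rs rs'(1,2), symmetric] using rs rs' by (intro rel) auto
    then show "y = r \<odot>\<^bsub>N\<^esub> n\<^sub>1 \<oplus>\<^bsub>N\<^esub> s \<odot>\<^bsub>N\<^esub> n\<^sub>2"
      using rs rs' n N.minus_equality[of y "\<ominus>\<^bsub>N\<^esub> (r \<odot>\<^bsub>N\<^esub> n\<^sub>1 \<oplus>\<^bsub>N\<^esub> s \<odot>\<^bsub>N\<^esub> n\<^sub>2)"]
        N.minus_equality[of "r \<odot>\<^bsub>N\<^esub> n\<^sub>1 \<oplus>\<^bsub>N\<^esub> s \<odot>\<^bsub>N\<^esub> n\<^sub>2" "\<ominus>\<^bsub>N\<^esub> y"] by (simp add: a_minus_def)
  qed (intro bexI[OF _ rs(1)] bexI[OF _ rs(2)] conjI refl)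
  have "f \<in> mod_hom R M N"
  proof (rule mod_homI)
    fix x assume "x \<in> carrier M"
    with gen obtain r s where rs: "r \<in> carrier R" "s \<in> carrier R"
      and x: "x = r \<odot>\<^bsub>M\<^esub> m\<^sub>1 \<oplus>\<^bsub>M\<^esub> s \<odot>\<^bsub>M\<^esub> m\<^sub>2" by blast
    show "f x \<in> carrier N" unfolding x f[OF rs] using rs n by simp
    show "f (t \<odot>\<^bsub>M\<^esub> x) = t \<odot>\<^bsub>N\<^esub> f x" if t: "t \<in> carrier R" for t
      using f[of "t \<otimes>\<^bsub>R\<^esub> r" "t \<otimes>\<^bsub>R\<^esub> s"] f[OF rs] rs t m n
      by (simp add: x M.smult_r_distr N.smult_r_distr M.smult_assoc1 N.smult_assoc1)
    fix y assume "y \<in> carrier M"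
    with gen obtain r' s' where rs': "r' \<in> carrier R" "s' \<in> carrier R"
      and y: "y = r' \<odot>\<^bsub>M\<^esub> m\<^sub>1 \<oplus>\<^bsub>M\<^esub> s' \<odot>\<^bsub>M\<^esub> m\<^sub>2" by blast
    show "f (x \<oplus>\<^bsub>M\<^esub> y) = f x \<oplus>\<^bsub>N\<^esub> f y"
      using f[of "r \<oplus>\<^bsub>R\<^esub> r'" "s \<oplus>\<^bsub>R\<^esub> s'"] f[OF rs] f[OF rs'] rs rs' m n
      by (simp add: x y M.smult_l_distr N.smult_l_distr M.M.a_ac N.M.a_ac)
  qed
  moreover have "f m\<^sub>1 = n\<^sub>1" "f m\<^sub>2 = n\<^sub>2"
    using f[of "\<one>\<^bsub>R\<^esub>" "\<zero>\<^bsub>R\<^esub>"] f[of "\<zero>\<^bsub>R\<^esub>" "\<one>\<^bsub>R\<^esub>"] m n by simp_all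
  ultimately show ?thesis by blast
qed


section \<open>Lifting relations modulo a submodule\<close>

text \<open>A relation \<open>r a + s b = 0\<close> in \<open>V\<close> amounts to a homomorphism to \<open>V\<close> from the finitely presented
  module \<open>G = R\<^sup>2/R(r, s)\<close>; lifting its composition with \<open>u\<close> through \<open>p\<close> lifts the relation.\<close>

lemma rel_flat_lift_relation:
  fixes R :: "('a, 'b) ring_scheme"
  assumes flat: "rel_flat R M V" and M': "module R M'"
    and p: "p \<in> mod_hom R M M'" "p ` carrier M = carrier M'" and u: "u \<in> mod_hom R V M'"
    and ab: "a \<in> carrier V" "b \<in> carrier V" and rs: "r \<in> carrier R" "s \<in> carrier R"
    and rel: "r \<odot>\<^bsub>V\<^esub> a \<oplus>\<^bsub>V\<^esub> s \<odot>\<^bsub>V\<^esub> b = \<zero>\<^bsub>V\<^esub>"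
  shows "\<exists>q\<^sub>1\<in>carrier M. \<exists>q\<^sub>2\<in>carrier M.
    p q\<^sub>1 = u a \<and> p q\<^sub>2 = u b \<and> r \<odot>\<^bsub>M\<^esub> q\<^sub>1 \<oplus>\<^bsub>M\<^esub> s \<odot>\<^bsub>M\<^esub> q\<^sub>2 = \<zero>\<^bsub>M\<^esub>"
proof -
  have modM: "module R M" and modV: "module R V" using flat unfolding rel_flat_def by blast+
  interpret V: module R V by (rule modV)
  interpret M: module R M by (rule modM)
  define F where "F = direct_power (ideal_module R (carrier R)) 2"
  have F: "module R F"
    unfolding F_def by (intro module_direct_power module_ideal_module V.R.oneideal V.R.is_cring)
  define pr :: "'a \<Rightarrow> 'a \<Rightarrow> nat \<Rightarrow> 'a" where "pr x y = (\<lambda>i\<in>{..<2}. if i = 0 then x else y)" for x y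
  have prF: "pr x y \<in> carrier F" if "x \<in> carrier R" "y \<in> carrier R" for x y
    using that by (auto simp: pr_def F_def direct_power_def ideal_module_def)
  have F_ops: "f \<oplus>\<^bsub>F\<^esub> g = pr (f 0 \<oplus>\<^bsub>R\<^esub> g 0) (f 1 \<oplus>\<^bsub>R\<^esub> g 1)"
    "x \<odot>\<^bsub>F\<^esub> f = pr (x \<otimes>\<^bsub>R\<^esub> f 0) (x \<otimes>\<^bsub>R\<^esub> f 1)" "\<zero>\<^bsub>F\<^esub> = pr \<zero>\<^bsub>R\<^esub> \<zero>\<^bsub>R\<^esub>" for f g x
    by (auto simp: pr_def F_def direct_power_def ideal_module_def fun_eq_iff less_2_cases_iff)
  have pr_sel: "pr x y 0 = x" "pr x y 1 = y" "pr x y (Suc 0) = y" for x y by (simp_all add: pr_def)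
  have pr_eta: "f = pr (f 0) (f 1)" "f 0 \<in> carrier R" "f 1 \<in> carrier R" if "f \<in> carrier F" for f
    using that
    by (auto simp: pr_def F_def direct_power_def ideal_module_def fun_eq_iff PiE_iff
        extensional_def less_2_cases_iff)
  define K where "K = submodule_span R F {pr r s}"
  have KS: "{pr r s} \<subseteq> carrier F" using prF rs by simp
  have K: "submodule K R F" unfolding K_def by (rule submodule_span_submodule[OF F KS])
  define G where "G = quotient_module F K"
  interpret FF: module R F by (rule F)
  have G: "module R G" unfolding G_def by (rule module_quotient_module[OF F K])
  interpret G: module R G by (rule G)
  have fp: "finitely_presented R G"
    unfolding G_def K_def F_def
    using KS by (intro finitely_presented_quotient V.R.is_cring) (simp_all add: F_def)
  let ?c = "\<lambda>f. K +>\<^bsub>F\<^esub> f"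
  have c: "?c \<in> mod_hom R F G" unfolding G_def by (rule coset_mod_hom[OF F K])
  have csurj: "?c ` carrier F = carrier G" unfolding G_def by (rule coset_surj[OF F K])
  define e\<^sub>1 where "e\<^sub>1 = pr \<one>\<^bsub>R\<^esub> \<zero>\<^bsub>R\<^esub>"
  define e\<^sub>2 where "e\<^sub>2 = pr \<zero>\<^bsub>R\<^esub> \<one>\<^bsub>R\<^esub>"
  have eF: "e\<^sub>1 \<in> carrier F" "e\<^sub>2 \<in> carrier F" unfolding e\<^sub>1_def e\<^sub>2_def by (auto intro: prF)
  have comb: "x \<odot>\<^bsub>G\<^esub> ?c e\<^sub>1 \<oplus>\<^bsub>G\<^esub> y \<odot>\<^bsub>G\<^esub> ?c e\<^sub>2 = ?c (pr x y)"
    if xy: "x \<in> carrier R" "y \<in> carrier R" for x y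
  proof -
    have "x \<odot>\<^bsub>F\<^esub> e\<^sub>1 \<oplus>\<^bsub>F\<^esub> y \<odot>\<^bsub>F\<^esub> e\<^sub>2 = pr x y"
      using xy by (simp add: F_ops pr_sel e\<^sub>1_def e\<^sub>2_def)
    moreover have "?c (x \<odot>\<^bsub>F\<^esub> e\<^sub>1 \<oplus>\<^bsub>F\<^esub> y \<odot>\<^bsub>F\<^esub> e\<^sub>2) = x \<odot>\<^bsub>G\<^esub> ?c e\<^sub>1 \<oplus>\<^bsub>G\<^esub> y \<odot>\<^bsub>G\<^esub> ?c e\<^sub>2"
      using mod_homD(2)[OF c] mod_homD(3)[OF c] xy eF by simp
    ultimately show ?thesis by simp
  qed
  have "\<exists>v\<in>mod_hom R G V. v (?c e\<^sub>1) = a \<and> v (?c e\<^sub>2) = b"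
  proof (rule two_generated_hom[OF G modV mod_homD(1)[OF c eF(1)] mod_homD(1)[OF c eF(2)] ab])
    fix X assume "X \<in> carrier G"
    then obtain f where f: "f \<in> carrier F" "X = ?c f" unfolding csurj[symmetric] by blast
    have "X = f 0 \<odot>\<^bsub>G\<^esub> ?c e\<^sub>1 \<oplus>\<^bsub>G\<^esub> f 1 \<odot>\<^bsub>G\<^esub> ?c e\<^sub>2"
      unfolding comb[OF pr_eta(2,3)[OF f(1)]] f(2) using pr_eta(1)[OF f(1)] by simp
    then show "\<exists>x\<in>carrier R. \<exists>y\<in>carrier R. X = x \<odot>\<^bsub>G\<^esub> ?c e\<^sub>1 \<oplus>\<^bsub>G\<^esub> y \<odot>\<^bsub>G\<^esub> ?c e\<^sub>2"
      using pr_eta(2,3)[OF f(1)] by blast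
  next
    fix x y assume xy: "x \<in> carrier R" "y \<in> carrier R"
      and 0: "x \<odot>\<^bsub>G\<^esub> ?c e\<^sub>1 \<oplus>\<^bsub>G\<^esub> y \<odot>\<^bsub>G\<^esub> ?c e\<^sub>2 = \<zero>\<^bsub>G\<^esub>"
    \<comment> \<open>A relation that holds in \<open>G\<close> lies in the span of \<open>(r, s)\<close>, and the relations satisfied by \<open>a\<close>
      and \<open>b\<close> form a submodule that contains \<open>(r, s)\<close>.\<close>
    let ?H = "{f \<in> carrier F. f 0 \<odot>\<^bsub>V\<^esub> a \<oplus>\<^bsub>V\<^esub> f 1 \<odot>\<^bsub>V\<^esub> b = \<zero>\<^bsub>V\<^esub>}"
    have "submodule ?H R F"
    proof (rule FF.submoduleI)
      show "\<zero>\<^bsub>F\<^esub> \<in> ?H" using FF.M.zero_closed ab by (simp add: F_ops pr_sel)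
    next
      fix t f assume t: "t \<in> carrier R" and f: "f \<in> ?H"
      then have "t \<odot>\<^bsub>F\<^esub> f \<in> carrier F" by simp
      moreover have "(t \<otimes>\<^bsub>R\<^esub> f 0) \<odot>\<^bsub>V\<^esub> a \<oplus>\<^bsub>V\<^esub> (t \<otimes>\<^bsub>R\<^esub> f 1) \<odot>\<^bsub>V\<^esub> b =
          t \<odot>\<^bsub>V\<^esub> (f 0 \<odot>\<^bsub>V\<^esub> a \<oplus>\<^bsub>V\<^esub> f 1 \<odot>\<^bsub>V\<^esub> b)"
        using t ab pr_eta(2,3)[of f] CollectD[OF f, THEN conjunct1]
        by (simp add: V.smult_assoc1 V.smult_r_distr)
      ultimately show "t \<odot>\<^bsub>F\<^esub> f \<in> ?H" using f t by (simp add: F_ops pr_sel)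
    next
      fix f g assume fg: "f \<in> ?H" "g \<in> ?H"
      then have "f \<oplus>\<^bsub>F\<^esub> g \<in> carrier F" by simp
      moreover have "(f 0 \<oplus>\<^bsub>R\<^esub> g 0) \<odot>\<^bsub>V\<^esub> a \<oplus>\<^bsub>V\<^esub> (f 1 \<oplus>\<^bsub>R\<^esub> g 1) \<odot>\<^bsub>V\<^esub> b =
          (f 0 \<odot>\<^bsub>V\<^esub> a \<oplus>\<^bsub>V\<^esub> f 1 \<odot>\<^bsub>V\<^esub> b) \<oplus>\<^bsub>V\<^esub> (g 0 \<odot>\<^bsub>V\<^esub> a \<oplus>\<^bsub>V\<^esub> g 1 \<odot>\<^bsub>V\<^esub> b)"
        using ab pr_eta(2,3)[of f] pr_eta(2,3)[of g] CollectD[OF fg(1), THEN conjunct1]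
          CollectD[OF fg(2), THEN conjunct1] by (simp add: V.smult_l_distr V.M.a_ac)
      ultimately show "f \<oplus>\<^bsub>F\<^esub> g \<in> ?H" using fg by (simp add: F_ops pr_sel)
    next
      fix f assume f: "f \<in> ?H"
      have "\<ominus>\<^bsub>F\<^esub> f = (\<ominus>\<^bsub>R\<^esub> \<one>\<^bsub>R\<^esub>) \<odot>\<^bsub>F\<^esub> f" using f by (simp add: FF.smult_l_minus)
      also have "\<dots> = pr (\<ominus>\<^bsub>R\<^esub> f 0) (\<ominus>\<^bsub>R\<^esub> f 1)"
        using f pr_eta(2,3)[of f] by (simp add: F_ops V.R.l_minus)
      finally have eq: "\<ominus>\<^bsub>F\<^esub> f = pr (\<ominus>\<^bsub>R\<^esub> f 0) (\<ominus>\<^bsub>R\<^esub> f 1)" .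
      have "(\<ominus>\<^bsub>R\<^esub> f 0) \<odot>\<^bsub>V\<^esub> a \<oplus>\<^bsub>V\<^esub> (\<ominus>\<^bsub>R\<^esub> f 1) \<odot>\<^bsub>V\<^esub> b = \<ominus>\<^bsub>V\<^esub> (f 0 \<odot>\<^bsub>V\<^esub> a \<oplus>\<^bsub>V\<^esub> f 1 \<odot>\<^bsub>V\<^esub> b)"
        using ab pr_eta(2,3)[of f] CollectD[OF f, THEN conjunct1]
        by (simp add: V.smult_l_minus V.M.minus_add)
      also have "\<dots> = \<zero>\<^bsub>V\<^esub>" using f V.M.minus_equality[of "\<zero>\<^bsub>V\<^esub>" "\<zero>\<^bsub>V\<^esub>"] by simp
      finally show "\<ominus>\<^bsub>F\<^esub> f \<in> ?H" using f FF.M.a_inv_closed[of f] by (simp add: eq pr_sel)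
    qed auto
    moreover have "{pr r s} \<subseteq> ?H" using KS rel by (simp add: pr_sel)
    ultimately have "K \<subseteq> ?H" unfolding K_def submodule_span_def by blast
    moreover have "pr x y \<in> K"
      using 0 coset_eq_zero_iff[OF F K prF[OF xy], folded G_def] unfolding comb[OF xy] by simp
    ultimately have "pr x y \<in> ?H" by blast
    then show "x \<odot>\<^bsub>V\<^esub> a \<oplus>\<^bsub>V\<^esub> y \<odot>\<^bsub>V\<^esub> b = \<zero>\<^bsub>V\<^esub>" by (simp add: pr_sel)
  qed
  then obtain v where v: "v \<in> mod_hom R G V" "v (?c e\<^sub>1) = a" "v (?c e\<^sub>2) = b" by blast
  obtain q where q: "q \<in> mod_hom R G M" "\<forall>x\<in>carrier G. p (q x) = u (v x)"
    using rel_flatD[OF flat M' p u fp v(1)] by blast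
  have "r \<odot>\<^bsub>M\<^esub> q (?c e\<^sub>1) \<oplus>\<^bsub>M\<^esub> s \<odot>\<^bsub>M\<^esub> q (?c e\<^sub>2) =
      q (r \<odot>\<^bsub>G\<^esub> ?c e\<^sub>1 \<oplus>\<^bsub>G\<^esub> s \<odot>\<^bsub>G\<^esub> ?c e\<^sub>2)"
    using mod_homD(2)[OF q(1)] mod_homD(3)[OF q(1)] mod_homD(1)[OF c] eF rs by simp
  also have "\<dots> = q \<zero>\<^bsub>G\<^esub>"
  proof -
    have "pr r s \<in> K" unfolding K_def submodule_span_def by blast
    then show ?thesis
      unfolding comb[OF rs] using coset_eq_zero_iff[OF F K prF[OF rs], folded G_def] by simp
  qed
  also have "\<dots> = \<zero>\<^bsub>M\<^esub>" by (rule mod_hom_zero[OF G modM q(1)])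
  finally show ?thesis
    using v(2,3) q(2) mod_homD(1)[OF c] mod_homD(1)[OF q(1)] eF by metis
qed

text \<open>The case \<open>M = V\<close>, \<open>M' = V/W\<close>, with the map \<open>u : V \<rightarrow> V/W\<close> determined by its values \<open>y\<^sub>1\<close>, \<open>y\<^sub>2\<close>
  on the generators \<open>a\<close>, \<open>b\<close>; the hypothesis \<open>compat\<close> says that \<open>u\<close> is well defined. Any relation
  between the generators is satisfied, up to corrections in \<open>W\<close>, by \<open>y\<^sub>1\<close> and \<open>y\<^sub>2\<close>.\<close>

lemma quasi_flat_lift_pair:
  fixes R :: "('a, 'b) ring_scheme"
  assumes V: "module R V" and flat: "quasi_flat R V" and W: "submodule W R V"
    and ab: "a \<in> carrier V" "b \<in> carrier V"
    and gen: "\<And>x. x \<in> carrier V \<Longrightarrow>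
      \<exists>r\<in>carrier R. \<exists>s\<in>carrier R. x = r \<odot>\<^bsub>V\<^esub> a \<oplus>\<^bsub>V\<^esub> s \<odot>\<^bsub>V\<^esub> b"
    and y: "y\<^sub>1 \<in> carrier V" "y\<^sub>2 \<in> carrier V"
    and compat: "\<And>r s. r \<in> carrier R \<Longrightarrow> s \<in> carrier R \<Longrightarrow>
      r \<odot>\<^bsub>V\<^esub> a \<oplus>\<^bsub>V\<^esub> s \<odot>\<^bsub>V\<^esub> b = \<zero>\<^bsub>V\<^esub> \<Longrightarrow> r \<odot>\<^bsub>V\<^esub> y\<^sub>1 \<oplus>\<^bsub>V\<^esub> s \<odot>\<^bsub>V\<^esub> y\<^sub>2 \<in> W"
    and rs: "r \<in> carrier R" "s \<in> carrier R"
    and rel: "r \<odot>\<^bsub>V\<^esub> a \<oplus>\<^bsub>V\<^esub> s \<odot>\<^bsub>V\<^esub> b = \<zero>\<^bsub>V\<^esub>"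
  shows "\<exists>w\<^sub>1\<in>W. \<exists>w\<^sub>2\<in>W. r \<odot>\<^bsub>V\<^esub> (y\<^sub>1 \<oplus>\<^bsub>V\<^esub> w\<^sub>1) \<oplus>\<^bsub>V\<^esub> s \<odot>\<^bsub>V\<^esub> (y\<^sub>2 \<oplus>\<^bsub>V\<^esub> w\<^sub>2) = \<zero>\<^bsub>V\<^esub>"
proof -
  interpret V: module R V by (rule V)
  let ?Q = "quotient_module V W" and ?P = "direct_power V 1" and ?c = "\<lambda>x. W +>\<^bsub>V\<^esub> x"
  have Q: "module R ?Q" by (rule module_quotient_module[OF V W])
  note c = coset_mod_hom[OF V W]
  have c0: "?c x = \<zero>\<^bsub>?Q\<^esub> \<longleftrightarrow> x \<in> W" if "x \<in> carrier V" for x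
    by (rule coset_eq_zero_iff[OF V W that])
  have "\<exists>u\<in>mod_hom R V ?Q. u a = ?c y\<^sub>1 \<and> u b = ?c y\<^sub>2"
  proof (rule two_generated_hom[OF V Q ab mod_homD(1)[OF c y(1)] mod_homD(1)[OF c y(2)] gen])
    fix r s assume rs: "r \<in> carrier R" "s \<in> carrier R" "r \<odot>\<^bsub>V\<^esub> a \<oplus>\<^bsub>V\<^esub> s \<odot>\<^bsub>V\<^esub> b = \<zero>\<^bsub>V\<^esub>"
    have "?c (r \<odot>\<^bsub>V\<^esub> y\<^sub>1 \<oplus>\<^bsub>V\<^esub> s \<odot>\<^bsub>V\<^esub> y\<^sub>2) = r \<odot>\<^bsub>?Q\<^esub> ?c y\<^sub>1 \<oplus>\<^bsub>?Q\<^esub> s \<odot>\<^bsub>?Q\<^esub> ?c y\<^sub>2"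
      using mod_homD(2)[OF c] mod_homD(3)[OF c] rs y by simp
    then show "r \<odot>\<^bsub>?Q\<^esub> ?c y\<^sub>1 \<oplus>\<^bsub>?Q\<^esub> s \<odot>\<^bsub>?Q\<^esub> ?c y\<^sub>2 = \<zero>\<^bsub>?Q\<^esub>"
      using c0[of "r \<odot>\<^bsub>V\<^esub> y\<^sub>1 \<oplus>\<^bsub>V\<^esub> s \<odot>\<^bsub>V\<^esub> y\<^sub>2"] compat[OF rs] rs y by simp
  qed
  then obtain u where u: "u \<in> mod_hom R V ?Q" "u a = ?c y\<^sub>1" "u b = ?c y\<^sub>2" by blast
  have ev: "(\<lambda>f. f 0) \<in> mod_hom R ?P V" by (rule mod_homI) (auto simp: direct_power_def)
  have "(\<lambda>f. ?c (f 0)) ` carrier ?P = carrier ?Q"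
  proof -
    have "(\<lambda>f. f 0) ` carrier ?P = carrier V"
    proof (intro equalityI subsetI)
      fix x assume "x \<in> carrier V"
      then show "x \<in> (\<lambda>f. f 0) ` carrier ?P"
        by (intro image_eqI[of _ _ "\<lambda>i\<in>{..<1}. x"]) (auto simp: direct_power_def)
    qed (use mod_homD(1)[OF ev] in auto)
    then show ?thesis using coset_surj[OF V W] by (metis image_image)
  qed
  moreover have "rel_flat R ?P V" using flat unfolding quasi_flat_def by simp
  ultimately obtain q\<^sub>1 q\<^sub>2 where q: "q\<^sub>1 \<in> carrier ?P" "q\<^sub>2 \<in> carrier ?P"
      "?c (q\<^sub>1 0) = ?c y\<^sub>1" "?c (q\<^sub>2 0) = ?c y\<^sub>2" "r \<odot>\<^bsub>?P\<^esub> q\<^sub>1 \<oplus>\<^bsub>?P\<^esub> s \<odot>\<^bsub>?P\<^esub> q\<^sub>2 = \<zero>\<^bsub>?P\<^esub>"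
    using rel_flat_lift_relation[OF _ Q mod_hom_comp[OF ev c] _ u(1) ab rs rel] u(2,3) by metis
  have qV: "q\<^sub>1 0 \<in> carrier V" "q\<^sub>2 0 \<in> carrier V" using q(1,2) mod_homD(1)[OF ev] by auto
  have w: "q\<^sub>1 0 \<ominus>\<^bsub>V\<^esub> y\<^sub>1 \<in> W" "q\<^sub>2 0 \<ominus>\<^bsub>V\<^esub> y\<^sub>2 \<in> W"
    using coset_eq_iff[OF V W qV(1) y(1)] coset_eq_iff[OF V W qV(2) y(2)] q(3,4) by simp_all
  have eq: "y\<^sub>1 \<oplus>\<^bsub>V\<^esub> (q\<^sub>1 0 \<ominus>\<^bsub>V\<^esub> y\<^sub>1) = q\<^sub>1 0" "y\<^sub>2 \<oplus>\<^bsub>V\<^esub> (q\<^sub>2 0 \<ominus>\<^bsub>V\<^esub> y\<^sub>2) = q\<^sub>2 0"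
    using qV y V.M.a_lcomm[of "y\<^sub>1" "q\<^sub>1 0" "\<ominus>\<^bsub>V\<^esub> y\<^sub>1"] V.M.a_lcomm[of "y\<^sub>2" "q\<^sub>2 0" "\<ominus>\<^bsub>V\<^esub> y\<^sub>2"]
    by (simp_all add: a_minus_def V.M.r_neg)
  have "(r \<odot>\<^bsub>?P\<^esub> q\<^sub>1 \<oplus>\<^bsub>?P\<^esub> s \<odot>\<^bsub>?P\<^esub> q\<^sub>2) 0 = \<zero>\<^bsub>?P\<^esub> 0" using q(5) by simp
  then have "r \<odot>\<^bsub>V\<^esub> q\<^sub>1 0 \<oplus>\<^bsub>V\<^esub> s \<odot>\<^bsub>V\<^esub> q\<^sub>2 0 = \<zero>\<^bsub>V\<^esub>" by (simp add: direct_power_def)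
  then show ?thesis using w eq by metis
qed


section \<open>Annihilators of elements of a local fqf-ring\<close>

definition (in cring) incomparable :: "'a \<Rightarrow> 'a \<Rightarrow> bool" where
  "incomparable a b \<longleftrightarrow> a \<in> carrier R \<and> b \<in> carrier R \<and> a \<notin> PIdl b \<and> b \<notin> PIdl a"

lemma (in cring) incomparable_sym: "incomparable a b \<Longrightarrow> incomparable b a"
  by (auto simp: incomparable_def)

lemma (in cring) incomparable_nonzero: "incomparable a b \<Longrightarrow> a \<noteq> \<zero>"
  using additive_subgroup.zero_closed[OF ideal.axioms(1)[OF cgenideal_ideal]]
  by (auto simp: incomparable_def)

lemma (in cring) mem_cgenideal: "x \<in> PIdl a \<longleftrightarrow> (\<exists>r\<in>carrier R. x = r \<otimes> a)"
  by (auto simp: cgenideal_def)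

lemma (in cring) genideal_pair:
  assumes ab: "a \<in> carrier R" "b \<in> carrier R"
  shows "Idl {a, b} = {r \<otimes> a \<oplus> s \<otimes> b | r s. r \<in> carrier R \<and> s \<in> carrier R}" (is "_ = ?V")
proof
  have V: "?V = PIdl a <+> PIdl b"
    unfolding set_add_def' cgenideal_def by blast
  have "ideal ?V R" unfolding V by (intro add_ideals cgenideal_ideal ab)
  moreover have "a = \<one> \<otimes> a \<oplus> \<zero> \<otimes> b" "b = \<zero> \<otimes> a \<oplus> \<one> \<otimes> b" using ab by simp_all
  then have "{a, b} \<subseteq> ?V" by blast
  ultimately show "Idl {a, b} \<subseteq> ?V" by (rule genideal_minimal)
  have J: "ideal (Idl {a, b}) R" and "a \<in> Idl {a, b}" "b \<in> Idl {a, b}"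
    using genideal_ideal[of "{a, b}"] genideal_self[of "{a, b}"] ab by auto
  then show "?V \<subseteq> Idl {a, b}"
    using ideal.I_l_closed[OF J] additive_subgroup.a_closed[OF ideal.axioms(1)[OF J]] by blast
qed

lemma submodule_ideal_module:
  assumes R: "cring R" and V: "ideal V R" and W: "ideal W R" and sub: "W \<subseteq> V"
  shows "submodule W R (ideal_module R V)"
  using module_ideal_module[OF R W] sub
  by (intro module.module_incl_imp_submodule[OF module_ideal_module[OF R V]])
     (simp_all add: ideal_module_def)

context local_fqf_ring
begin

lemma lift_pair:
  assumes ab: "a \<in> carrier R" "b \<in> carrier R" and W: "ideal W R" "W \<subseteq> Idl {a, b}"
    and y: "y\<^sub>1 \<in> Idl {a, b}" "y\<^sub>2 \<in> Idl {a, b}"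
    and compat: "\<And>r s. r \<in> carrier R \<Longrightarrow> s \<in> carrier R \<Longrightarrow>
      r \<otimes> a \<oplus> s \<otimes> b = \<zero> \<Longrightarrow> r \<otimes> y\<^sub>1 \<oplus> s \<otimes> y\<^sub>2 \<in> W"
    and rs: "r \<in> carrier R" "s \<in> carrier R" and rel: "r \<otimes> a \<oplus> s \<otimes> b = \<zero>"
  shows "\<exists>w\<^sub>1\<in>W. \<exists>w\<^sub>2\<in>W. r \<otimes> (y\<^sub>1 \<oplus> w\<^sub>1) \<oplus> s \<otimes> (y\<^sub>2 \<oplus> w\<^sub>2) = \<zero>"
proof -
  let ?V = "Idl {a, b}"
  have V: "ideal ?V R" using genideal_ideal[of "{a, b}"] ab by simp
  have "fg_ideal ?V R" unfolding fg_ideal_def using V ab by (intro conjI exI[of _ "{a, b}"]) auto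
  then have flat: "quasi_flat R (ideal_module R ?V)" using fqf unfolding fqf_ring_def by blast
  have abV: "a \<in> ?V" "b \<in> ?V" using genideal_self[of "{a, b}"] ab by auto
  have gen: "\<exists>r\<in>carrier R. \<exists>s\<in>carrier R. x = r \<otimes> a \<oplus> s \<otimes> b" if "x \<in> ?V" for x
    using that unfolding genideal_pair[OF ab] by blast
  show ?thesis
    using quasi_flat_lift_pair[OF module_ideal_module[OF is_cring V] flat
        submodule_ideal_module[OF is_cring V W], of a b y\<^sub>1 y\<^sub>2 r s]
    using abV gen y compat rs rel by (simp add: ideal_module_def)
qed

text \<open>Take \<open>W = (a) \<inter> (b)\<close>. The projection of \<open>V/W = (a)/W \<oplus> (b)/W\<close> onto the first summand gives
  \<open>y\<^sub>1 = a\<close>, \<open>y\<^sub>2 = 0\<close>. Corrections in \<open>W\<close> are nonunit multiples \<open>c a\<close> and \<open>d b\<close>, so the lifted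
  relation reads \<open>(1 + c - d) r a = 0\<close> with a unit in front.\<close>

lemma incomparable_inter:
  assumes inc: "incomparable a b" and rs: "r \<in> carrier R" "s \<in> carrier R"
    and eq: "r \<otimes> a = s \<otimes> b"
  shows "r \<otimes> a = \<zero>"
proof -
  have ab: "a \<in> carrier R" "b \<in> carrier R" "a \<notin> PIdl b" "b \<notin> PIdl a"
    using inc by (auto simp: incomparable_def)
  let ?W = "PIdl a \<inter> PIdl b"
  have W: "ideal ?W R" by (intro i_intersect cgenideal_ideal ab)
  have V: "ideal (Idl {a, b}) R" using genideal_ideal[of "{a, b}"] ab by simp
  have aV: "a \<in> Idl {a, b}" using genideal_self[of "{a, b}"] ab by auto
  have "\<exists>w\<^sub>1\<in>?W. \<exists>w\<^sub>2\<in>?W. r \<otimes> (a \<oplus> w\<^sub>1) \<oplus> (\<ominus> s) \<otimes> (\<zero> \<oplus> w\<^sub>2) = \<zero>"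
  proof (rule lift_pair[OF ab(1,2) W])
    show "?W \<subseteq> Idl {a, b}" using cgenideal_minimal[OF V aV] by blast
    show "a \<in> Idl {a, b}" "\<zero> \<in> Idl {a, b}"
      using aV additive_subgroup.zero_closed[OF ideal.axioms(1)[OF V]] by auto
    show "r \<otimes> a \<oplus> \<ominus> s \<otimes> b = \<zero>" using rs ab by (simp add: eq l_minus r_neg)
  next
    fix x y assume xy: "x \<in> carrier R" "y \<in> carrier R" and 0: "x \<otimes> a \<oplus> y \<otimes> b = \<zero>"
    then have "x \<otimes> a = \<ominus> (y \<otimes> b)" using ab minus_equality[OF 0] by simp
    then have "x \<otimes> a = (\<ominus> y) \<otimes> b" using xy ab by (simp add: l_minus)
    then have "x \<otimes> a \<in> ?W" using xy unfolding Int_iff mem_cgenideal by (metis a_inv_closed)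
    then show "x \<otimes> a \<oplus> y \<otimes> \<zero> \<in> ?W" using xy ab by simp
  qed (use rs in auto)
  then obtain w\<^sub>1 w\<^sub>2 where w: "w\<^sub>1 \<in> ?W" "w\<^sub>2 \<in> ?W"
      "r \<otimes> (a \<oplus> w\<^sub>1) \<oplus> (\<ominus> s) \<otimes> (\<zero> \<oplus> w\<^sub>2) = \<zero>" by blast
  obtain c where c: "c \<in> carrier R" "w\<^sub>1 = c \<otimes> a" using w(1) mem_cgenideal by blast
  obtain d where d: "d \<in> carrier R" "w\<^sub>2 = d \<otimes> b" using w(2) mem_cgenideal by blast
  have cd: "c \<otimes> a \<in> PIdl b" "d \<otimes> b \<in> PIdl a" using w(1,2) c d by auto
  have 0: "r \<otimes> (a \<oplus> c \<otimes> a) \<oplus> (\<ominus> s) \<otimes> (\<zero> \<oplus> d \<otimes> b) = \<zero>" using w(3) c d by simp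
  have nonunits: "c \<notin> Units R" "\<ominus> d \<notin> Units R"
  proof -
    show "c \<notin> Units R" using unit_multiple[OF _ ab(1,2) cd(1)] ab(3) by blast
    have "(\<ominus> d) \<otimes> b \<in> PIdl a"
      using additive_subgroup.a_inv_closed[OF ideal.axioms(1)[OF cgenideal_ideal[OF ab(1)]] cd(2)]
        d(1) ab by (simp add: l_minus)
    then show "\<ominus> d \<notin> Units R" using unit_multiple[OF _ ab(2,1)] ab(4) by blast
  qed
  have "(\<one> \<oplus> (c \<oplus> \<ominus> d)) \<otimes> (r \<otimes> a) = r \<otimes> (a \<oplus> c \<otimes> a) \<oplus> \<ominus> (d \<otimes> (r \<otimes> a))"
    using c(1) d(1) rs ab by (simp add: l_distr r_distr l_minus r_minus a_ac m_ac)
  also have "\<dots> = r \<otimes> (a \<oplus> c \<otimes> a) \<oplus> (\<ominus> s) \<otimes> (\<zero> \<oplus> d \<otimes> b)"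
    unfolding eq using c(1) d(1) rs ab by (simp add: l_minus r_minus m_ac)
  finally have "(\<one> \<oplus> (c \<oplus> \<ominus> d)) \<otimes> (r \<otimes> a) = \<zero>" using 0 by simp
  moreover have "\<one> \<oplus> (c \<oplus> \<ominus> d) \<in> Units R"
    using c(1) d(1) nonunits by (intro one_add_nonunit nonunits_add) auto
  ultimately show ?thesis using unit_cancel rs ab by simp
qed

text \<open>By \<open>incomparable_inter\<close> the sum \<open>(a) + (b)\<close> is direct, so \<open>a \<mapsto> b\<close>, \<open>b \<mapsto> 0\<close> is well defined modulo
  \<open>W = (0:a) b\<close>. Lifting the relation \<open>r a = 0\<close> along it gives \<open>(1 + c) r b = 0\<close> with \<open>c a = 0\<close>,
  where \<open>c\<close> is a nonunit because \<open>a \<noteq> 0\<close>.\<close>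

lemma incomparable_kills:
  assumes inc: "incomparable a b" and r: "r \<in> carrier R" and 0: "r \<otimes> a = \<zero>"
  shows "r \<otimes> b = \<zero>"
proof -
  have ab: "a \<in> carrier R" "b \<in> carrier R" using inc by (auto simp: incomparable_def)
  let ?W = "{x \<otimes> b | x. x \<in> carrier R \<and> x \<otimes> a = \<zero>}"
  have W: "ideal ?W R"
  proof (rule idealI[OF ring_axioms])
    show "subgroup ?W (add_monoid R)"
    proof (rule add.subgroupI)
      show "?W \<noteq> {}" using ab by (auto intro!: exI[of _ \<zero>])
      show "\<ominus> w \<in> ?W" if "w \<in> ?W" for w
      proof -
        obtain x where "x \<in> carrier R" "x \<otimes> a = \<zero>" "w = x \<otimes> b" using \<open>w \<in> ?W\<close> by blast
        then show ?thesis using ab by (auto simp: l_minus intro!: exI[of _ "\<ominus> x"])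
      qed
      show "w \<oplus> w' \<in> ?W" if "w \<in> ?W" "w' \<in> ?W" for w w'
      proof -
        obtain x where "x \<in> carrier R" "x \<otimes> a = \<zero>" "w = x \<otimes> b" using \<open>w \<in> ?W\<close> by blast
        moreover obtain x' where "x' \<in> carrier R" "x' \<otimes> a = \<zero>" "w' = x' \<otimes> b"
          using \<open>w' \<in> ?W\<close> by blast
        ultimately show ?thesis using ab by (auto simp: l_distr intro!: exI[of _ "x \<oplus> x'"])
      qed
    qed (use ab in auto)
    fix w t assume "w \<in> ?W" and t: "t \<in> carrier R"
    then obtain x where x: "x \<in> carrier R" "x \<otimes> a = \<zero>" "w = x \<otimes> b" by blast
    then have "t \<otimes> w = (t \<otimes> x) \<otimes> b" "(t \<otimes> x) \<otimes> a = \<zero>" using ab t by (simp_all add: m_assoc)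
    then show "t \<otimes> w \<in> ?W" using x t by blast
    then show "w \<otimes> t \<in> ?W" using x t ab by (simp add: m_comm)
  qed
  have V: "ideal (Idl {a, b}) R" using genideal_ideal[of "{a, b}"] ab by simp
  have bV: "b \<in> Idl {a, b}" using genideal_self[of "{a, b}"] ab by auto
  have "\<exists>w\<^sub>1\<in>?W. \<exists>w\<^sub>2\<in>?W. r \<otimes> (b \<oplus> w\<^sub>1) \<oplus> \<zero> \<otimes> (\<zero> \<oplus> w\<^sub>2) = \<zero>"
  proof (rule lift_pair[OF ab(1,2) W])
    show "?W \<subseteq> Idl {a, b}" using ideal.I_l_closed[OF V bV] by blast
    show "b \<in> Idl {a, b}" "\<zero> \<in> Idl {a, b}"
      using bV additive_subgroup.zero_closed[OF ideal.axioms(1)[OF V]] by auto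
    show "r \<otimes> a \<oplus> \<zero> \<otimes> b = \<zero>" using 0 ab by simp
  next
    fix x y assume xy: "x \<in> carrier R" "y \<in> carrier R" and 0: "x \<otimes> a \<oplus> y \<otimes> b = \<zero>"
    then have "x \<otimes> a = \<ominus> (y \<otimes> b)" using ab minus_equality[OF 0] by simp
    then have "x \<otimes> a = (\<ominus> y) \<otimes> b" using xy ab by (simp add: l_minus)
    then have "x \<otimes> a = \<zero>" by (rule incomparable_inter[OF inc xy(1) a_inv_closed[OF xy(2)]])
    then show "x \<otimes> b \<oplus> y \<otimes> \<zero> \<in> ?W" using xy ab by auto
  qed (use r in auto)
  then obtain c d where c: "c \<in> carrier R" "c \<otimes> a = \<zero>" and d: "d \<in> carrier R"
    and "r \<otimes> (b \<oplus> c \<otimes> b) \<oplus> \<zero> \<otimes> (\<zero> \<oplus> d \<otimes> b) = \<zero>"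
    by blast
  then have "(\<one> \<oplus> c) \<otimes> (r \<otimes> b) = \<zero>"
    using r ab by (simp add: l_distr r_distr m_ac)
  moreover have "c \<notin> Units R" using unit_cancel[OF _ ab(1) c(2)] incomparable_nonzero[OF inc] by blast
  ultimately show ?thesis using unit_cancel[OF one_add_nonunit] c r ab by simp
qed

lemma incomparable_annihilator:
  assumes "incomparable a b" "r \<in> carrier R"
  shows "r \<otimes> a = \<zero> \<longleftrightarrow> r \<otimes> b = \<zero>"
  using incomparable_kills[OF assms] incomparable_kills[OF incomparable_sym[OF assms(1)] assms(2)]
  by blast

lemma incomparable_square:
  assumes "incomparable a b"
  shows "a \<otimes> a = \<zero>"
proof -
  have ab: "a \<in> carrier R" "b \<in> carrier R" using assms by (auto simp: incomparable_def)
  have "b \<otimes> a = a \<otimes> b" by (rule m_comm[OF ab(2,1)])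
  then have "b \<otimes> a = \<zero>" by (rule incomparable_inter[OF assms ab(2,1)])
  then have "a \<otimes> b = \<zero>" using ab by (simp add: m_comm)
  then show ?thesis using incomparable_annihilator[OF assms ab(1)] by blast
qed

text \<open>If \<open>x\<close> is comparable with both \<open>a\<close> and \<open>b\<close> and does not divide both, then, by incomparability of
  \<open>a\<close> and \<open>b\<close>, it is a multiple of both, hence zero.\<close>

lemma annihilator_if_not_common_divisor:
  assumes inc: "incomparable a b" and x: "x \<in> carrier R" "x \<noteq> \<zero>"
    and ndiv: "\<not> (a \<in> PIdl x \<and> b \<in> PIdl x)" and r: "r \<in> carrier R"
  shows "r \<otimes> x = \<zero> \<longleftrightarrow> r \<otimes> a = \<zero>"
proof -
  have ab: "a \<in> carrier R" "b \<in> carrier R" "a \<notin> PIdl b" "b \<notin> PIdl a"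
    using inc by (auto simp: incomparable_def)
  have trans: "z \<in> PIdl v" if "z \<in> PIdl w" "w \<in> PIdl v" "v \<in> carrier R" for z w v
    using that ideal.I_l_closed[OF cgenideal_ideal[OF that(3)] that(2)] by (auto simp: mem_cgenideal)
  consider "incomparable x a" | "incomparable x b" | "x \<in> PIdl a" "x \<in> PIdl b"
    using ndiv x(1) ab trans[of a x b] trans[of b x a] unfolding incomparable_def by blast
  then show ?thesis
  proof cases
    case 3
    then obtain s t where "s \<in> carrier R" "t \<in> carrier R" "x = s \<otimes> a" "x = t \<otimes> b"
      by (auto simp: mem_cgenideal)
    then have "x = \<zero>" using incomparable_inter[OF inc] by metis
    with x show ?thesis by simp
  qed (use incomparable_annihilator r inc in blast)+
qed

text \<open>If \<open>a = s x\<close>, then \<open>s\<close> does not divide \<open>b\<close>: from \<open>b = t x = u s\<close> it would follow that \<open>x\<close>, \<open>u\<close> are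
  incomparable and \<open>b \<in> (x) \<inter> (u) = 0\<close>. So \<open>s\<close> has the annihilator of \<open>a\<close>, but \<open>x s = a \<noteq> 0\<close>.\<close>

lemma common_divisor_not_annihilating:
  assumes inc: "incomparable a b" and x: "x \<in> carrier R" "a \<in> PIdl x" "b \<in> PIdl x"
  shows "x \<otimes> a \<noteq> \<zero>"
proof
  assume xa: "x \<otimes> a = \<zero>"
  have ab: "a \<in> carrier R" "b \<in> carrier R" "a \<notin> PIdl b" "b \<notin> PIdl a"
    using inc by (auto simp: incomparable_def)
  obtain s t where s: "s \<in> carrier R" "a = s \<otimes> x" and t: "t \<in> carrier R" "b = t \<otimes> x"
    using x by (auto simp: mem_cgenideal)
  have "b \<notin> PIdl s"
  proof
    assume "b \<in> PIdl s"
    then obtain u where u: "u \<in> carrier R" "b = u \<otimes> s" by (auto simp: mem_cgenideal)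
    have "incomparable x u"
      unfolding incomparable_def
    proof (intro conjI notI)
      assume "x \<in> PIdl u"
      then obtain w where w: "w \<in> carrier R" "x = w \<otimes> u" by (auto simp: mem_cgenideal)
      have "a = w \<otimes> b" using s u w by (simp add: m_ac)
      then show False using w ab by (auto simp: mem_cgenideal)
    next
      assume "u \<in> PIdl x"
      then obtain w where w: "w \<in> carrier R" "u = w \<otimes> x" by (auto simp: mem_cgenideal)
      have "b = w \<otimes> a" using s u w x(1) by (simp add: m_ac)
      then show False using w ab by (auto simp: mem_cgenideal)
    qed (use x u in auto)
    moreover have "t \<otimes> x = s \<otimes> u" using u s t by (simp add: m_comm)
    ultimately have "b = \<zero>" using incomparable_inter[OF _ t(1) s(1)] t(2) by simp
    then show False using incomparable_nonzero[OF incomparable_sym[OF inc]] by simp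
  qed
  moreover have "s \<noteq> \<zero>" using s x incomparable_nonzero[OF inc] by auto
  ultimately have "x \<otimes> s = \<zero>"
    using annihilator_if_not_common_divisor[OF inc s(1)] xa x by blast
  then show False using s x incomparable_nonzero[OF inc] by (simp add: m_comm)
qed

text \<open>Let \<open>x\<close> divide \<open>a\<close> and \<open>b\<close>, and let \<open>r x = 0\<close> with \<open>r \<noteq> 0\<close>. Then \<open>r a = 0\<close>, so \<open>r\<close> is not such a
  common divisor and its annihilator, which contains \<open>x\<close>, is that of \<open>a\<close>; but \<open>x a \<noteq> 0\<close>.\<close>

lemma annihilator_trichotomy:
  assumes inc: "incomparable a b" and x: "x \<in> carrier R" "x \<noteq> \<zero>"
  shows "(\<forall>r\<in>carrier R. r \<otimes> x = \<zero> \<longleftrightarrow> r \<otimes> a = \<zero>) \<or> (\<forall>r\<in>carrier R. r \<otimes> x = \<zero> \<longrightarrow> r = \<zero>)"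
proof (cases "a \<in> PIdl x \<and> b \<in> PIdl x")
  case False
  then show ?thesis using annihilator_if_not_common_divisor[OF inc x] by blast
next
  case True
  have a: "a \<in> carrier R" using inc by (simp add: incomparable_def)
  have xa: "x \<otimes> a \<noteq> \<zero>" using common_divisor_not_annihilating[OF inc x(1)] True by blast
  have "r = \<zero>" if r: "r \<in> carrier R" "r \<otimes> x = \<zero>" for r
  proof (rule ccontr)
    assume "r \<noteq> \<zero>"
    obtain s where s: "s \<in> carrier R" "a = s \<otimes> x" using True by (auto simp: mem_cgenideal)
    have "r \<otimes> a = s \<otimes> (r \<otimes> x)" using r(1) s x by (simp add: m_ac)
    then have "r \<otimes> a = \<zero>" using r s by simp
    then have "\<not> (a \<in> PIdl r \<and> b \<in> PIdl r)"
      using common_divisor_not_annihilating[OF inc r(1)] by blast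
    then have "x \<otimes> r = \<zero> \<longleftrightarrow> x \<otimes> a = \<zero>"
      by (rule annihilator_if_not_common_divisor[OF inc r(1) \<open>r \<noteq> \<zero>\<close> _ x(1)])
    then show False using xa r x by (simp add: m_comm)
  qed
  then show ?thesis by blast
qed

text \<open>A regular element is comparable with every element, because elements with an incomparable partner
  square to zero; and a divisor of a regular element is regular.\<close>

lemma regular_finite_subset_principal:
  assumes I: "ideal I R" and g: "g \<in> I" "\<And>r. r \<in> carrier R \<Longrightarrow> r \<otimes> g = \<zero> \<Longrightarrow> r = \<zero>"
    and X: "finite X" "X \<subseteq> I"
  shows "\<exists>g\<in>I. (\<forall>r\<in>carrier R. r \<otimes> g = \<zero> \<longrightarrow> r = \<zero>) \<and> X \<subseteq> PIdl g"
  using X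
proof (induction X rule: finite_induct)
  case empty
  then show ?case using g by blast
next
  case (insert y X)
  then obtain h where h: "h \<in> I" "\<forall>r\<in>carrier R. r \<otimes> h = \<zero> \<longrightarrow> r = \<zero>" "X \<subseteq> PIdl h" by blast
  have hy: "h \<in> carrier R" "y \<in> carrier R" using ideal.Icarr[OF I] h insert.prems by auto
  have "\<not> incomparable h y"
    using incomparable_square[of h y] incomparable_nonzero[of h y] h(2) hy by blast
  then consider "y \<in> PIdl h" | "h \<in> PIdl y" using hy by (auto simp: incomparable_def)
  then show ?case
  proof cases
    case 1
    then show ?thesis using h by blast
  next
    case 2
    then obtain s where s: "s \<in> carrier R" "h = s \<otimes> y" by (auto simp: mem_cgenideal)
    have "r = \<zero>" if "r \<in> carrier R" "r \<otimes> y = \<zero>" for r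
    proof -
      have "r \<otimes> h = s \<otimes> (r \<otimes> y)" using that(1) s hy by (simp add: m_ac)
      then show ?thesis using h(2) that s by simp
    qed
    moreover have "PIdl h \<subseteq> PIdl y" by (rule cgenideal_minimal[OF cgenideal_ideal[OF hy(2)] 2])
    ultimately show ?thesis using h(3) insert.prems cgenideal_self[OF hy(2)] by blast
  qed
qed

lemma exists_incomparable:
  assumes "\<not> chain_ring R"
  shows "\<exists>a b. incomparable a b"
proof -
  obtain I J where "ideal I R" "ideal J R" "\<not> I \<subseteq> J" "\<not> J \<subseteq> I"
    using assms is_cring unfolding chain_ring_def by blast
  then obtain a b where ab: "a \<in> I" "a \<notin> J" "b \<in> J" "b \<notin> I" by blast
  have "incomparable a b"
    unfolding incomparable_def
    using ab cgenideal_minimal[OF \<open>ideal I R\<close> ab(1)] cgenideal_minimal[OF \<open>ideal J R\<close> ab(3)]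
      ideal.Icarr[OF \<open>ideal I R\<close>] ideal.Icarr[OF \<open>ideal J R\<close>] by blast
  then show ?thesis by blast
qed

text \<open>The common annihilator of the nonzero elements of \<open>I\<close> is \<open>(0:a)\<close> for any incomparable pair \<open>a\<close>, \<open>b\<close>. If
  \<open>c\<close> has an incomparable partner, then \<open>c \<otimes> c = \<zero>\<close>, so \<open>c\<close> is not regular, \<open>(0:c) = (0:a)\<close>, and \<open>c\<close>
  itself lies in this annihilator.\<close>

lemma torsion_free_mod_annihilator:
  assumes chain: "\<not> chain_ring R" and I: "ideal I R"
    and no_regular: "\<forall>x\<in>I. \<exists>r\<in>carrier R. r \<otimes> x = \<zero> \<and> r \<noteq> \<zero>"
  shows "\<And>r x. r \<in> carrier R \<Longrightarrow> x \<in> I \<Longrightarrow> r \<otimes> x = \<zero> \<Longrightarrow> r \<in> annihilator R I \<or> x = \<zero>"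
    and "\<And>c d. c \<in> carrier R \<Longrightarrow> d \<in> carrier R \<Longrightarrow>
      c \<in> PIdl d \<or> d \<in> PIdl c \<or> c \<in> annihilator R I"
proof -
  obtain a b where inc: "incomparable a b" using exists_incomparable[OF chain] by blast
  have same: "r \<otimes> x = \<zero> \<longleftrightarrow> r \<otimes> a = \<zero>" if "r \<in> carrier R" "x \<in> I" "x \<noteq> \<zero>" for r x
    using annihilator_trichotomy[OF inc ideal.Icarr[OF I that(2)] that(3)] bspec[OF no_regular that(2)]
      that(1) by blast
  have ann: "r \<in> annihilator R I" if "r \<in> carrier R" "r \<otimes> a = \<zero>" for r
  proof -
    have "r \<otimes> x = \<zero>" if "x \<in> I" for x
      using same[OF \<open>r \<in> carrier R\<close> that] \<open>r \<otimes> a = \<zero>\<close> \<open>r \<in> carrier R\<close> by (cases "x = \<zero>") auto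
    then show ?thesis using that by (simp add: annihilator_def)
  qed
  show "r \<in> annihilator R I \<or> x = \<zero>" if "r \<in> carrier R" "x \<in> I" "r \<otimes> x = \<zero>" for r x
    using same[OF that(1,2)] ann that by blast
  show "c \<in> PIdl d \<or> d \<in> PIdl c \<or> c \<in> annihilator R I" if cd: "c \<in> carrier R" "d \<in> carrier R" for c d
  proof (cases "incomparable c d")
    case True
    then have "c \<otimes> c = \<zero>" "c \<noteq> \<zero>" using incomparable_square incomparable_nonzero by blast+
    then have "c \<otimes> a = \<zero>" using annihilator_trichotomy[OF inc cd(1)] cd(1) by blast
    then show ?thesis using ann cd(1) by blast
  qed (use cd in \<open>auto simp: incomparable_def\<close>)
qed

end


section \<open>Tensor kernels\<close>

text \<open>Membership in the tensor kernel is witnessed by finitely many relators, and these involve only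
  finitely many elements of \<open>M\<close>.\<close>

lemma tensor_kernel_local:
  fixes R :: "('a, 'b) ring_scheme" and M :: "('a, 'm) module" and N :: "('a, 'n) module"
  assumes M: "module R M" and N: "module R N" and c: "c \<in> tensor_kernel R M N"
  shows "\<exists>X. finite X \<and> X \<subseteq> carrier M \<and>
    (\<forall>H. submodule H R M \<longrightarrow> X \<subseteq> H \<longrightarrow> c \<in> tensor_kernel R (M\<lparr>carrier := H\<rparr>) N)"
proof -
  have rel: "\<exists>X. finite X \<and> X \<subseteq> carrier M \<and>
      (\<forall>H. submodule H R M \<longrightarrow> X \<subseteq> H \<longrightarrow> h \<in> tensor_relators R (M\<lparr>carrier := H\<rparr>) N)"
    if "h \<in> tensor_relators R M N" for h
  proof -
    from that consider
      (1) x x' y where "h = frag_of (x \<oplus>\<^bsub>M\<^esub> x', y) - frag_of (x, y) - frag_of (x', y)"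
        "x \<in> carrier M" "x' \<in> carrier M" "y \<in> carrier N"
    | (2) x y y' where "h = frag_of (x, y \<oplus>\<^bsub>N\<^esub> y') - frag_of (x, y) - frag_of (x, y')"
        "x \<in> carrier M" "y \<in> carrier N" "y' \<in> carrier N"
    | (3) r x y where "h = frag_of (r \<odot>\<^bsub>M\<^esub> x, y) - frag_of (x, r \<odot>\<^bsub>N\<^esub> y)"
        "r \<in> carrier R" "x \<in> carrier M" "y \<in> carrier N"
      unfolding tensor_relators_def by blast
    then show ?thesis
    proof cases
      case 1
      then show ?thesis by (intro exI[of _ "{x, x'}"]) (auto simp: tensor_relators_def)
    next
      case 2
      then show ?thesis by (intro exI[of _ "{x}"]) (auto simp: tensor_relators_def)
    next
      case 3
      then show ?thesis by (intro exI[of _ "{x}"]) (auto simp: tensor_relators_def)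
    qed
  qed
  from c show ?thesis
    unfolding tensor_kernel_def
  proof (induction rule: generate.induct)
    case one
    have "0 \<in> generate (free_Abelian_group (H \<times> carrier N)) T" for H :: "'m set" and T
      using generate.one[of "free_Abelian_group (H \<times> carrier N)"] by simp
    then show ?case by auto
  next
    case (incl h)
    then show ?case using rel[OF incl] generate.incl by metis
  next
    case (inv h)
    obtain X where X: "finite X" "X \<subseteq> carrier M"
      "\<And>H. submodule H R M \<Longrightarrow> X \<subseteq> H \<Longrightarrow> h \<in> tensor_relators R (M\<lparr>carrier := H\<rparr>) N"
      using rel[OF inv] by blast
    have "inv\<^bsub>free_Abelian_group (carrier M \<times> carrier N)\<^esub> h = - h"
      using keys_tensor_relators[OF M N inv] by simp
    moreover have "- h \<in> generate (free_Abelian_group (carrier (M\<lparr>carrier := H\<rparr>) \<times> carrier N))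
        (tensor_relators R (M\<lparr>carrier := H\<rparr>) N)"
      if "submodule H R M" "X \<subseteq> H" for H
      using generate.inv[OF X(3)[OF that]]
        keys_tensor_relators[OF submodule.submodule_is_module[OF that(1) M] N X(3)[OF that]]
        inv_free_Abelian_group
      by metis
    ultimately show ?case using X(1,2) by auto
  next
    case (eng h h')
    then obtain X X' where "finite X" "X \<subseteq> carrier M" "finite X'" "X' \<subseteq> carrier M"
      and XX': "\<And>H. submodule H R M \<Longrightarrow> X \<subseteq> H \<Longrightarrow>
        h \<in> generate (free_Abelian_group (carrier (M\<lparr>carrier := H\<rparr>) \<times> carrier N))
          (tensor_relators R (M\<lparr>carrier := H\<rparr>) N)"
        "\<And>H. submodule H R M \<Longrightarrow> X' \<subseteq> H \<Longrightarrow>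
        h' \<in> generate (free_Abelian_group (carrier (M\<lparr>carrier := H\<rparr>) \<times> carrier N))
          (tensor_relators R (M\<lparr>carrier := H\<rparr>) N)"
      by blast
    moreover have "h \<otimes>\<^bsub>free_Abelian_group (carrier M \<times> carrier N)\<^esub> h' \<in>
        generate (free_Abelian_group (carrier (M\<lparr>carrier := H\<rparr>) \<times> carrier N))
          (tensor_relators R (M\<lparr>carrier := H\<rparr>) N)"
      if "submodule H R M" "X \<union> X' \<subseteq> H" for H
      using generate.eng[OF XX'(1)[of H] XX'(2)[of H]] that by simp
    ultimately show ?case by (intro exI[of _ "X \<union> X'"]) auto
  qed
qed

lemma hom_free_Abelian_group_diff:
  assumes "group G" "g \<in> hom (free_Abelian_group S) G"
    and "Poly_Mapping.keys a \<subseteq> S" "Poly_Mapping.keys b \<subseteq> S"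
  shows "g (a - b) = g a \<otimes>\<^bsub>G\<^esub> inv\<^bsub>G\<^esub> (g b)"
proof -
  interpret group_hom "free_Abelian_group S" G g
    using assms by (intro group_hom.intro) (auto simp: group_hom_axioms_def)
  have "a \<otimes>\<^bsub>free_Abelian_group S\<^esub> inv\<^bsub>free_Abelian_group S\<^esub> b = a - b"
    using assms(4) by simp
  then have "g (a - b) = g (a \<otimes>\<^bsub>free_Abelian_group S\<^esub> inv\<^bsub>free_Abelian_group S\<^esub> b)"
    by (rule arg_cong[OF sym])
  also have "\<dots> = g a \<otimes>\<^bsub>G\<^esub> inv\<^bsub>G\<^esub> (g b)"
    using assms(3,4) hom_mult[of a "inv\<^bsub>free_Abelian_group S\<^esub> b"] hom_inv[of b]
      G.inv_closed[of b] by (simp only: carrier_free_Abelian_group_iff)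
  finally show ?thesis .
qed

lemma hom_free_Abelian_group_eq:
  assumes "group G" "g \<in> hom (free_Abelian_group S) G" "h \<in> hom (free_Abelian_group S) G"
    and "\<And>s. s \<in> S \<Longrightarrow> g (frag_of s) = h (frag_of s)" and "Poly_Mapping.keys c \<subseteq> S"
  shows "g c = h c"
proof (rule free_Abelian_group_induct[OF assms(5)])
  show "g 0 = h 0"
    using hom_one[OF assms(2) group_free_Abelian_group assms(1)]
      hom_one[OF assms(3) group_free_Abelian_group assms(1)] by simp
  show "g (x - y) = h (x - y)"
    if "Poly_Mapping.keys x \<subseteq> S" "Poly_Mapping.keys y \<subseteq> S" "g x = h x" "g y = h y" for x y
    using hom_free_Abelian_group_diff[OF assms(1,2) that(1,2)]
      hom_free_Abelian_group_diff[OF assms(1,3) that(1,2)] that(3,4) by simp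
qed (fact assms(4))

text \<open>The universal property of the tensor product: \<open>g\<close> is balanced and biadditive on the generators
  \<open>frag_of (x, y)\<close>, so it kills the relators.\<close>

lemma tensor_kernel_bilinear:
  fixes R :: "('a, 'b) ring_scheme"
  assumes M: "module R M" and N: "module R N" and G: "comm_group G"
    and g: "g \<in> hom (free_Abelian_group (carrier M \<times> carrier N)) G"
    and g1: "\<And>x x' y. x \<in> carrier M \<Longrightarrow> x' \<in> carrier M \<Longrightarrow> y \<in> carrier N \<Longrightarrow>
      g (frag_of (x \<oplus>\<^bsub>M\<^esub> x', y)) = g (frag_of (x, y)) \<otimes>\<^bsub>G\<^esub> g (frag_of (x', y))"
    and g2: "\<And>x y y'. x \<in> carrier M \<Longrightarrow> y \<in> carrier N \<Longrightarrow> y' \<in> carrier N \<Longrightarrow>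
      g (frag_of (x, y \<oplus>\<^bsub>N\<^esub> y')) = g (frag_of (x, y)) \<otimes>\<^bsub>G\<^esub> g (frag_of (x, y'))"
    and g3: "\<And>r x y. r \<in> carrier R \<Longrightarrow> x \<in> carrier M \<Longrightarrow> y \<in> carrier N \<Longrightarrow>
      g (frag_of (r \<odot>\<^bsub>M\<^esub> x, y)) = g (frag_of (x, r \<odot>\<^bsub>N\<^esub> y))"
    and c: "c \<in> tensor_kernel R M N"
  shows "g c = \<one>\<^bsub>G\<^esub>"
proof -
  interpret M: module R M by (rule M)
  interpret N: module R N by (rule N)
  interpret G: comm_group G by (rule G)
  interpret g: group_hom "free_Abelian_group (carrier M \<times> carrier N)" G g
    using g by (intro group_hom.intro) (auto simp: group_hom_axioms_def)
  note diff = hom_free_Abelian_group_diff[OF G.group_axioms g]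
  have gc: "g (frag_of (x, y)) \<in> carrier G" if "x \<in> carrier M" "y \<in> carrier N" for x y
    using that by (intro g.hom_closed) simp
  have kd: "Poly_Mapping.keys (a - b) \<subseteq> S"
    if "Poly_Mapping.keys a \<subseteq> S" "Poly_Mapping.keys b \<subseteq> S"
    for a b :: "_ \<Rightarrow>\<^sub>0 int" and S using keys_diff[of a b] that by blast
  have kf: "Poly_Mapping.keys (frag_of (x, y)) \<subseteq> carrier M \<times> carrier N"
    if "x \<in> carrier M" "y \<in> carrier N" for x y using that by simp
  have rel: "g h = \<one>\<^bsub>G\<^esub>" if "h \<in> tensor_relators R M N" for h
  proof -
    from that consider
      (1) x x' y where "h = frag_of (x \<oplus>\<^bsub>M\<^esub> x', y) - frag_of (x, y) - frag_of (x', y)"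
        "x \<in> carrier M" "x' \<in> carrier M" "y \<in> carrier N"
    | (2) x y y' where "h = frag_of (x, y \<oplus>\<^bsub>N\<^esub> y') - frag_of (x, y) - frag_of (x, y')"
        "x \<in> carrier M" "y \<in> carrier N" "y' \<in> carrier N"
    | (3) r x y where "h = frag_of (r \<odot>\<^bsub>M\<^esub> x, y) - frag_of (x, r \<odot>\<^bsub>N\<^esub> y)"
        "r \<in> carrier R" "x \<in> carrier M" "y \<in> carrier N"
      unfolding tensor_relators_def by blast
    then show ?thesis
    proof cases
      case 1
      then show ?thesis by (simp add: diff kd kf gc g1 G.m_ac)
    next
      case 2
      then show ?thesis by (simp add: diff kd kf gc g2 G.m_ac)
    next
      case 3
      then show ?thesis by (simp add: diff kd kf gc g3)
    qed
  qed
  have carr: "c \<in> carrier (free_Abelian_group (carrier M \<times> carrier N))"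
    if "c \<in> tensor_kernel R M N" for c
    using that normal_imp_subgroup[OF tensor_kernel_normal[OF M N]] subgroup.subset by blast
  from c show ?thesis
    unfolding tensor_kernel_def
  proof (induction rule: generate.induct)
    case one
    show ?case using g.hom_one .
  next
    case (inv h)
    then show ?case using keys_tensor_relators[OF M N inv] rel[OF inv] by (subst g.hom_inv) auto
  next
    case (eng h h')
    then show ?case
      using carr[unfolded tensor_kernel_def, of h] carr[unfolded tensor_kernel_def, of h']
      by (subst g.hom_mult) auto
  qed (use rel in auto)
qed

text \<open>The map \<open>M \<otimes> P \<rightarrow> P\<close>, \<open>x \<otimes> y \<mapsto> l(x) y\<close>, that is induced by a linear functional \<open>l\<close> on \<open>M\<close>.\<close>

lemma functional_induces_map:
  fixes R :: "('a, 'b) ring_scheme" and M :: "('a, 'm) module" and P :: "('a, 'q) module"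
  assumes M: "module R M" and P: "module R P" and l: "l \<in> mod_hom R M (ideal_module R (carrier R))"
  shows "\<exists>g\<in>hom (free_Abelian_group (carrier M \<times> carrier P)) (add_monoid P).
    (\<forall>x\<in>carrier M. \<forall>y\<in>carrier P. g (frag_of (x, y)) = l x \<odot>\<^bsub>P\<^esub> y) \<and>
    (\<forall>d\<in>tensor_kernel R M P. g d = \<zero>\<^bsub>P\<^esub>)"
proof -
  interpret M: module R M by (rule M)
  interpret P: module R P by (rule P)
  have l_closed: "l x \<in> carrier R" if "x \<in> carrier M" for x
    using mod_homD(1)[OF l that] by (simp add: ideal_module_def)
  have l_add: "l (x \<oplus>\<^bsub>M\<^esub> y) = l x \<oplus>\<^bsub>R\<^esub> l y" if "x \<in> carrier M" "y \<in> carrier M" for x y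
    using mod_homD(2)[OF l that] by (simp add: ideal_module_def)
  have l_smult: "l (r \<odot>\<^bsub>M\<^esub> x) = r \<otimes>\<^bsub>R\<^esub> l x" if "r \<in> carrier R" "x \<in> carrier M" for r x
    using mod_homD(3)[OF l that] by (simp add: ideal_module_def)
  have "(\<lambda>(x, y). l x \<odot>\<^bsub>P\<^esub> y) ` (carrier M \<times> carrier P) \<subseteq> carrier (add_monoid P)"
    using l_closed by auto
  from comm_group.free_Abelian_group_universal[OF P.M.a_comm_group this]
  obtain g where g: "g \<in> hom (free_Abelian_group (carrier M \<times> carrier P)) (add_monoid P)"
    "\<And>z. z \<in> carrier M \<times> carrier P \<Longrightarrow> g (frag_of z) = (\<lambda>(x, y). l x \<odot>\<^bsub>P\<^esub> y) z" by blast
  have eq: "g (frag_of (x, y)) = l x \<odot>\<^bsub>P\<^esub> y" if "x \<in> carrier M" "y \<in> carrier P" for x y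
    using g(2)[of "(x, y)"] that by simp
  have "g d = \<one>\<^bsub>add_monoid P\<^esub>" if d: "d \<in> tensor_kernel R M P" for d
  proof (rule tensor_kernel_bilinear[OF M P P.M.a_comm_group g(1) _ _ _ d])
    fix r x y assume "r \<in> carrier R" "x \<in> carrier M" "y \<in> carrier P"
    then show "g (frag_of (r \<odot>\<^bsub>M\<^esub> x, y)) = g (frag_of (x, r \<odot>\<^bsub>P\<^esub> y))"
      by (simp add: eq l_smult l_closed M.R.m_comm[of r] P.smult_assoc1)
  qed (simp_all add: eq l_closed l_add P.smult_l_distr P.smult_r_distr)
  then show ?thesis using g(1) eq by (intro bexI[of _ g]) auto
qed

text \<open>This is injectivity of \<open>M \<otimes> N \<rightarrow> M \<otimes> N'\<close> for elements whose images vanish for a reason inside a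
  submodule \<open>H\<close> with a finite dual basis. The coordinate maps \<open>g b : H \<otimes> N \<rightarrow> N\<close> commute with \<open>f\<close>, so
  all coordinates of \<open>c\<close> vanish; and \<open>c\<close> is the sum of the \<open>b \<otimes> g b c\<close>, because \<open>x\<close> is the sum of
  the \<open>l b x \<odot> b\<close>.\<close>

lemma tensor_kernel_reflects:
  fixes R :: "('a, 'b) ring_scheme" and M :: "('a, 'm) module"
    and N :: "('a, 'n) module" and N' :: "('a, 'p) module"
  assumes M: "module R M" and N: "module R N" and N': "module R N'"
    and f: "f \<in> mod_hom R N N'" "inj_on f (carrier N)"
    and H: "submodule H R M" and B: "finite B" "B \<subseteq> H"
    and l: "\<And>b. b \<in> B \<Longrightarrow> l b \<in> mod_hom R (M\<lparr>carrier := H\<rparr>) (ideal_module R (carrier R))"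
    and basis: "\<And>x. x \<in> H \<Longrightarrow> x = (\<Oplus>\<^bsub>M\<^esub>b\<in>B. l b x \<odot>\<^bsub>M\<^esub> b)"
    and c: "Poly_Mapping.keys c \<subseteq> H \<times> carrier N"
    and 0: "frag_extend (\<lambda>(x, y). frag_of (x, f y)) c \<in> tensor_kernel R (M\<lparr>carrier := H\<rparr>) N'"
  shows "c \<in> tensor_kernel R M N"
proof -
  interpret M: module R M by (rule M)
  interpret N: module R N by (rule N)
  interpret N': module R N' by (rule N')
  let ?H = "M\<lparr>carrier := H\<rparr>" and ?K = "tensor_kernel R M N"
  have mH: "module R ?H" by (rule submodule.submodule_is_module[OF H M])
  have HM: "H \<subseteq> carrier M" by (rule subgroup.subset[OF submodule.axioms(1)[OF H], simplified])
  have l_closed: "l b x \<in> carrier R" if "b \<in> B" "x \<in> H" for b x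
    using mod_homD(1)[OF l[OF that(1)], of x] that(2) by (simp add: ideal_module_def)
  have coord: "\<exists>g\<in>hom (free_Abelian_group (H \<times> carrier N)) (add_monoid N).
      \<forall>x\<in>H. \<forall>y\<in>carrier N. g (frag_of (x, y)) = l b x \<odot>\<^bsub>N\<^esub> y" if "b \<in> B" for b
    using functional_induces_map[OF mH N l[OF that]] by auto
  obtain g where g: "\<And>b. b \<in> B \<Longrightarrow> g b \<in> hom (free_Abelian_group (H \<times> carrier N)) (add_monoid N)"
    "\<And>b x y. b \<in> B \<Longrightarrow> x \<in> H \<Longrightarrow> y \<in> carrier N \<Longrightarrow> g b (frag_of (x, y)) = l b x \<odot>\<^bsub>N\<^esub> y"
    using bchoice[of B "\<lambda>b g. g \<in> hom (free_Abelian_group (H \<times> carrier N)) (add_monoid N) \<and>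
      (\<forall>x\<in>H. \<forall>y\<in>carrier N. g (frag_of (x, y)) = l b x \<odot>\<^bsub>N\<^esub> y)"] coord by blast
  have g_closed: "g b d \<in> carrier N" if "b \<in> B" "Poly_Mapping.keys d \<subseteq> H \<times> carrier N" for b d
    using hom_in_carrier[OF g(1)[OF that(1)], of d] that(2) by simp
  have gc: "g b c = \<zero>\<^bsub>N\<^esub>" if b: "b \<in> B" for b
  proof -
    let ?\<phi> = "frag_extend (\<lambda>(x, y). frag_of (x, f y))"
    obtain g' where g': "g' \<in> hom (free_Abelian_group (H \<times> carrier N')) (add_monoid N')"
      "\<forall>x\<in>H. \<forall>y\<in>carrier N'. g' (frag_of (x, y)) = l b x \<odot>\<^bsub>N'\<^esub> y"
      "\<forall>d\<in>tensor_kernel R ?H N'. g' d = \<zero>\<^bsub>N'\<^esub>"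
      using functional_induces_map[OF mH N' l[OF b]] by auto
    have \<phi>: "?\<phi> \<in> hom (free_Abelian_group (H \<times> carrier N)) (free_Abelian_group (H \<times> carrier N'))"
      using phi_hom[OF mH N N' f(1)] by simp
    have fhom: "f \<in> hom (add_monoid N) (add_monoid N')" using f(1) by (simp add: mod_hom_def)
    have "f (g b c) = g' (?\<phi> c)"
    proof (rule hom_free_Abelian_group_eq[where g = "\<lambda>d. f (g b d)" and h = "\<lambda>d. g' (?\<phi> d)"])
      show "group (add_monoid N')" by (rule N'.a_group)
      show "(\<lambda>d. f (g b d)) \<in> hom (free_Abelian_group (H \<times> carrier N)) (add_monoid N')"
        using hom_compose[OF g(1)[OF b] fhom] by (simp add: comp_def)
      show "(\<lambda>d. g' (?\<phi> d)) \<in> hom (free_Abelian_group (H \<times> carrier N)) (add_monoid N')"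
        using hom_compose[OF \<phi> g'(1)] by (simp add: comp_def)
      show "Poly_Mapping.keys c \<subseteq> H \<times> carrier N" by (rule c)
      fix z assume "z \<in> H \<times> carrier N"
      then obtain x y where "z = (x, y)" "x \<in> H" "y \<in> carrier N" by blast
      then show "f (g b (frag_of z)) = g' (?\<phi> (frag_of z))"
        using g(2)[OF b] g'(2) mod_homD(1,3)[OF f(1)] l_closed[OF b] by simp
    qed
    also have "\<dots> = \<zero>\<^bsub>N'\<^esub>" using g'(3) 0 by blast
    also have "\<dots> = f \<zero>\<^bsub>N\<^esub>"
      using hom_one[OF fhom N.a_group N'.a_group] by simp
    finally show ?thesis
      using inj_onD[OF f(2)] g_closed[OF b c] by simp
  qed
  interpret K: subgroup ?K "free_Abelian_group (carrier M \<times> carrier N)"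
    by (rule normal_imp_subgroup[OF tensor_kernel_normal[OF M N]])
  have K0: "0 \<in> ?K" using K.one_closed by simp
  have Kadd: "a + b \<in> ?K" if "a \<in> ?K" "b \<in> ?K" for a b
    using K.m_closed[OF that] by simp
  have Kneg: "- a \<in> ?K" if "a \<in> ?K" for a
    using K.m_inv_closed[OF that] K.mem_carrier[OF that] by simp
  have Kdiff: "a - b \<in> ?K" if "a \<in> ?K" "b \<in> ?K" for a b
    using Kadd[OF that(1) Kneg[OF that(2)]] by simp
  have Ksum: "sum h B \<in> ?K" if "\<And>b. b \<in> B \<Longrightarrow> h b \<in> ?K" for h
    using B(1) that by (induction B rule: finite_induct) (auto intro: K0 Kadd)
  have k1: "frag_of (x \<oplus>\<^bsub>M\<^esub> x', y) - frag_of (x, y) - frag_of (x', y) \<in> ?K"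
    if "x \<in> carrier M" "x' \<in> carrier M" "y \<in> carrier N" for x x' y
    unfolding tensor_kernel_def tensor_relators_def using that by (intro generate.incl) blast
  have k2: "frag_of (x, y \<oplus>\<^bsub>N\<^esub> y') - frag_of (x, y) - frag_of (x, y') \<in> ?K"
    if "x \<in> carrier M" "y \<in> carrier N" "y' \<in> carrier N" for x y y'
    unfolding tensor_kernel_def tensor_relators_def using that by (intro generate.incl) blast
  have k3: "frag_of (r \<odot>\<^bsub>M\<^esub> x, y) - frag_of (x, r \<odot>\<^bsub>N\<^esub> y) \<in> ?K"
    if "r \<in> carrier R" "x \<in> carrier M" "y \<in> carrier N" for r x y
    unfolding tensor_kernel_def tensor_relators_def using that by (intro generate.incl) blast
  have zero_r: "frag_of (x, \<zero>\<^bsub>N\<^esub>) \<in> ?K" if "x \<in> carrier M" for x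
    using Kneg[OF k2[OF that N.zero_closed N.zero_closed]] by simp
  have zero_l: "frag_of (\<zero>\<^bsub>M\<^esub>, y) \<in> ?K" if "y \<in> carrier N" for y
    using Kneg[OF k1[OF M.M.zero_closed M.M.zero_closed that]] by simp
  have expand: "frag_of (\<Oplus>\<^bsub>M\<^esub>b\<in>B'. r b \<odot>\<^bsub>M\<^esub> b, y) - (\<Sum>b\<in>B'. frag_of (b, r b \<odot>\<^bsub>N\<^esub> y)) \<in> ?K"
    if B': "finite B'" "B' \<subseteq> H" and r: "\<And>b. b \<in> B' \<Longrightarrow> r b \<in> carrier R" and y: "y \<in> carrier N" for B' r y
    using B' r
  proof (induction B' rule: finite_induct)
    case empty
    then show ?case using zero_l[OF y] by simp
  next
    case (insert b B')
    have b: "b \<in> carrier M" "r b \<in> carrier R" using insert HM by auto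
    have S: "(\<Oplus>\<^bsub>M\<^esub>b\<in>B'. r b \<odot>\<^bsub>M\<^esub> b) \<in> carrier M"
      using insert HM by (intro M.finsum_closed) auto
    have "(\<Oplus>\<^bsub>M\<^esub>b\<in>insert b B'. r b \<odot>\<^bsub>M\<^esub> b) = r b \<odot>\<^bsub>M\<^esub> b \<oplus>\<^bsub>M\<^esub> (\<Oplus>\<^bsub>M\<^esub>b\<in>B'. r b \<odot>\<^bsub>M\<^esub> b)"
      using insert HM by (intro M.finsum_insert) auto
    moreover have "frag_of (r b \<odot>\<^bsub>M\<^esub> b \<oplus>\<^bsub>M\<^esub> (\<Oplus>\<^bsub>M\<^esub>b\<in>B'. r b \<odot>\<^bsub>M\<^esub> b), y) -
        (frag_of (b, r b \<odot>\<^bsub>N\<^esub> y) + (\<Sum>b\<in>B'. frag_of (b, r b \<odot>\<^bsub>N\<^esub> y))) \<in> ?K"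
    proof -
      have IH: "frag_of (\<Oplus>\<^bsub>M\<^esub>b\<in>B'. r b \<odot>\<^bsub>M\<^esub> b, y) - (\<Sum>b\<in>B'. frag_of (b, r b \<odot>\<^bsub>N\<^esub> y)) \<in> ?K"
        using insert by auto
      show ?thesis
        using Kadd[OF Kadd[OF k1[OF M.smult_closed[OF b(2,1)] S y] k3[OF b(2,1) y]] IH]
        by (simp add: algebra_simps)
    qed
    ultimately show ?case using insert.hyps by simp
  qed
  have decompose: "d - (\<Sum>b\<in>B. frag_of (b, g b d)) \<in> ?K" if d: "Poly_Mapping.keys d \<subseteq> H \<times> carrier N" for d
  proof -
    have "Poly_Mapping.keys d \<subseteq> H \<times> carrier N \<and> d - (\<Sum>b\<in>B. frag_of (b, g b d)) \<in> ?K"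
      using d
    proof (induction d rule: frag_induction)
      case zero
      have "g b 0 = \<zero>\<^bsub>N\<^esub>" if "b \<in> B" for b
        using hom_one[OF g(1)[OF that] group_free_Abelian_group N.a_group] by simp
      then have "frag_of (b, g b 0) \<in> ?K" if "b \<in> B" for b using that zero_r B HM by auto
      then have "(\<Sum>b\<in>B. frag_of (b, g b 0)) \<in> ?K" by (rule Ksum)
      then show ?case using Kneg by simp
    next
      case (one z)
      then obtain x y where z: "z = (x, y)" "x \<in> H" "y \<in> carrier N" by blast
      have "frag_of (\<Oplus>\<^bsub>M\<^esub>b\<in>B. l b x \<odot>\<^bsub>M\<^esub> b, y) - (\<Sum>b\<in>B. frag_of (b, l b x \<odot>\<^bsub>N\<^esub> y)) \<in> ?K"
        using B z l_closed by (intro expand) auto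
      then show ?case using z g(2) basis[OF z(2)] by simp
    next
      case (diff d d')
      have k: "Poly_Mapping.keys (d - d') \<subseteq> H \<times> carrier N" using diff keys_diff[of d d'] by blast
      have "frag_of (b, g b d) - frag_of (b, g b (d - d')) - frag_of (b, g b d') \<in> ?K" if b: "b \<in> B" for b
      proof -
        have cl: "g b d \<in> carrier N" "g b d' \<in> carrier N" "g b (d - d') \<in> carrier N"
          using g_closed[OF b] diff k by auto
        have "g b (d - d') = g b d \<ominus>\<^bsub>N\<^esub> g b d'"
          using hom_free_Abelian_group_diff[OF N.a_group g(1)[OF b]] diff
          by (simp add: a_minus_def a_inv_def)
        then have "g b (d - d') \<oplus>\<^bsub>N\<^esub> g b d' = g b d"
          using cl by (simp add: a_minus_def N.M.a_assoc N.M.l_neg)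
        then show ?thesis using k2[of b "g b (d - d')" "g b d'"] cl b B HM by auto
      qed
      then have "(\<Sum>b\<in>B. frag_of (b, g b d) - frag_of (b, g b (d - d')) - frag_of (b, g b d')) \<in> ?K"
        by (rule Ksum)
      then have "(\<Sum>b\<in>B. frag_of (b, g b d)) - (\<Sum>b\<in>B. frag_of (b, g b (d - d'))) -
          (\<Sum>b\<in>B. frag_of (b, g b d')) \<in> ?K" by (simp add: sum_subtractf)
      from Kadd[OF Kdiff[OF conjunct2[OF diff(1)] conjunct2[OF diff(2)]] this]
      show ?case using k by (simp add: algebra_simps)
    qed
    then show ?thesis ..
  qed
  have "(\<Sum>b\<in>B. frag_of (b, g b c)) \<in> ?K"
  proof (rule Ksum)
    fix b assume "b \<in> B"
    then show "frag_of (b, g b c) \<in> ?K" using gc zero_r B HM by auto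
  qed
  from Kadd[OF decompose[OF c] this] show ?thesis by simp
qed

text \<open>Given an element \<open>c\<close> that becomes zero in \<open>M \<otimes> N'\<close>, choose \<open>H\<close> to contain the first components of
  \<open>c\<close> and all elements of \<open>M\<close> needed to see that its image is zero.\<close>

lemma flat_module_if_locally_dual_basis:
  fixes R :: "('a, 'b) ring_scheme" and M :: "('a, 'm) module"
  assumes M: "module R M"
    and loc: "\<And>X. finite X \<Longrightarrow> X \<subseteq> carrier M \<Longrightarrow> \<exists>H B l. submodule H R M \<and> X \<subseteq> H \<and>
      finite B \<and> B \<subseteq> H \<and> (\<forall>b\<in>B. l b \<in> mod_hom R (M\<lparr>carrier := H\<rparr>) (ideal_module R (carrier R))) \<and>
      (\<forall>x\<in>H. x = (\<Oplus>\<^bsub>M\<^esub>b\<in>B. l b x \<odot>\<^bsub>M\<^esub> b))"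
  shows "flat_module TYPE('n) TYPE('p) R M"
  unfolding flat_module_def
proof (intro conjI allI impI M)
  fix N :: "('a, 'n) module" and N' :: "('a, 'p) module" and f
  assume N: "module R N" and N': "module R N'" and f: "f \<in> mod_hom R N N'" "inj_on f (carrier N)"
  let ?K = "tensor_kernel R M N" and ?K' = "tensor_kernel R M N'"
  let ?FN = "free_Abelian_group (carrier M \<times> carrier N)"
  let ?FN' = "free_Abelian_group (carrier M \<times> carrier N')"
  let ?\<phi> = "frag_extend (\<lambda>(x, y). frag_of (x, f y))"
  interpret K: normal ?K ?FN by (rule tensor_kernel_normal[OF M N])
  interpret K': normal ?K' ?FN' by (rule tensor_kernel_normal[OF M N'])
  interpret T: group_hom "tensor_product R M N" "tensor_product R M N'" "tensor_map R M N N' f"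
    using tensor_map_hom[OF M N N' f(1)] K.factorgroup_is_group K'.factorgroup_is_group
    by (intro group_hom.intro) (auto simp: group_hom_axioms_def tensor_product_def)
  show "inj_on (tensor_map R M N N' f) (carrier (tensor_product R M N))"
    unfolding T.inj_on_one_iff
  proof (intro allI impI)
    fix X assume X: "X \<in> carrier (tensor_product R M N)"
      and 0: "tensor_map R M N N' f X = \<one>\<^bsub>tensor_product R M N'\<^esub>"
    obtain c where c: "c \<in> carrier ?FN" "X = ?K #>\<^bsub>?FN\<^esub> c"
      using X by (auto simp: tensor_product_def FactGroup_def RCOSETS_def)
    have \<phi>c: "?\<phi> c \<in> carrier ?FN'" by (rule hom_in_carrier[OF phi_hom[OF M N N' f(1)] c(1)])
    have "?K' #>\<^bsub>?FN'\<^esub> ?\<phi> c = ?K'"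
      using 0 tensor_map_coset[OF M N N' f(1) c(1)] c(2) by (simp add: tensor_product_def FactGroup_def)
    then have K': "?\<phi> c \<in> ?K'" by (rule K'.coset_join1[OF _ \<phi>c K'.subgroup_axioms])
    obtain X1 where X1: "finite X1" "X1 \<subseteq> carrier M"
      "\<And>H. submodule H R M \<Longrightarrow> X1 \<subseteq> H \<Longrightarrow> ?\<phi> c \<in> tensor_kernel R (M\<lparr>carrier := H\<rparr>) N'"
      using tensor_kernel_local[OF M N' K'] by blast
    have "finite (X1 \<union> fst ` Poly_Mapping.keys c)" "X1 \<union> fst ` Poly_Mapping.keys c \<subseteq> carrier M"
      using X1 c(1) by auto
    from loc[OF this] obtain H B l where H: "submodule H R M"
        "X1 \<union> fst ` Poly_Mapping.keys c \<subseteq> H"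
      and B: "finite B" "B \<subseteq> H"
        "\<forall>b\<in>B. l b \<in> mod_hom R (M\<lparr>carrier := H\<rparr>) (ideal_module R (carrier R))"
        "\<forall>x\<in>H. x = (\<Oplus>\<^bsub>M\<^esub>b\<in>B. l b x \<odot>\<^bsub>M\<^esub> b)"
      by blast
    have X1H: "X1 \<subseteq> H" using H(2) by blast
    have "Poly_Mapping.keys c \<subseteq> H \<times> carrier N" using H(2) c(1) by fastforce
    then have "c \<in> ?K"
      using B(3,4) X1(3)[OF H(1) X1H] tensor_kernel_reflects[OF M N N' f H(1) B(1,2), of l c] by blast
    then show "X = \<one>\<^bsub>tensor_product R M N\<^esub>"
      using K.coset_join2[OF c(1) K.subgroup_axioms] c(2)
      by (simp add: tensor_product_def FactGroup_def)
  qed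
qed


section \<open>Locally free modules and torsion-free modules\<close>

definition lin_span :: "('a, 'b) ring_scheme \<Rightarrow> ('a, 'm) module \<Rightarrow> 'm set \<Rightarrow> 'm set" where
  "lin_span R M B = {\<Oplus>\<^bsub>M\<^esub>b\<in>B. c b \<odot>\<^bsub>M\<^esub> b | c. c \<in> B \<rightarrow> carrier R}"

definition lin_indep :: "('a, 'b) ring_scheme \<Rightarrow> ('a, 'm) module \<Rightarrow> 'm set \<Rightarrow> bool" where
  "lin_indep R M B \<longleftrightarrow> (\<forall>c\<in>B \<rightarrow> carrier R.
     (\<Oplus>\<^bsub>M\<^esub>b\<in>B. c b \<odot>\<^bsub>M\<^esub> b) = \<zero>\<^bsub>M\<^esub> \<longrightarrow> (\<forall>b\<in>B. c b = \<zero>\<^bsub>R\<^esub>))"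

lemma lin_spanI: "c \<in> B \<rightarrow> carrier R \<Longrightarrow> (\<Oplus>\<^bsub>M\<^esub>b\<in>B. c b \<odot>\<^bsub>M\<^esub> b) \<in> lin_span R M B"
  by (auto simp: lin_span_def)

context
  fixes R :: "('a, 'b) ring_scheme" and M :: "('a, 'm) module" and B
  assumes M: "module R M" and B: "finite B" "B \<subseteq> carrier M"
begin

interpretation M: module R M by (rule M)

lemma lin_comb_closed: "c \<in> B \<rightarrow> carrier R \<Longrightarrow> (\<Oplus>\<^bsub>M\<^esub>b\<in>B. c b \<odot>\<^bsub>M\<^esub> b) \<in> carrier M"
  using B(2) by (intro M.M.finsum_closed) auto

lemma lin_comb_add:
  assumes "c \<in> B \<rightarrow> carrier R" "d \<in> B \<rightarrow> carrier R"
  shows "(\<Oplus>\<^bsub>M\<^esub>b\<in>B. (c b \<oplus>\<^bsub>R\<^esub> d b) \<odot>\<^bsub>M\<^esub> b) =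
    (\<Oplus>\<^bsub>M\<^esub>b\<in>B. c b \<odot>\<^bsub>M\<^esub> b) \<oplus>\<^bsub>M\<^esub> (\<Oplus>\<^bsub>M\<^esub>b\<in>B. d b \<odot>\<^bsub>M\<^esub> b)"
proof -
  have "(\<Oplus>\<^bsub>M\<^esub>b\<in>B. (c b \<oplus>\<^bsub>R\<^esub> d b) \<odot>\<^bsub>M\<^esub> b) = (\<Oplus>\<^bsub>M\<^esub>b\<in>B. c b \<odot>\<^bsub>M\<^esub> b \<oplus>\<^bsub>M\<^esub> d b \<odot>\<^bsub>M\<^esub> b)"
    using assms B(2) by (intro M.M.finsum_cong') (auto simp: Pi_iff subset_iff M.smult_l_distr)
  also have "\<dots> = (\<Oplus>\<^bsub>M\<^esub>b\<in>B. c b \<odot>\<^bsub>M\<^esub> b) \<oplus>\<^bsub>M\<^esub> (\<Oplus>\<^bsub>M\<^esub>b\<in>B. d b \<odot>\<^bsub>M\<^esub> b)"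
    using assms B(2) by (intro M.M.finsum_addf) auto
  finally show ?thesis .
qed

lemma lin_comb_smult:
  assumes "c \<in> B \<rightarrow> carrier R" "r \<in> carrier R"
  shows "(\<Oplus>\<^bsub>M\<^esub>b\<in>B. (r \<otimes>\<^bsub>R\<^esub> c b) \<odot>\<^bsub>M\<^esub> b) = r \<odot>\<^bsub>M\<^esub> (\<Oplus>\<^bsub>M\<^esub>b\<in>B. c b \<odot>\<^bsub>M\<^esub> b)"
proof -
  have "(\<Oplus>\<^bsub>M\<^esub>b\<in>B. (r \<otimes>\<^bsub>R\<^esub> c b) \<odot>\<^bsub>M\<^esub> b) = (\<Oplus>\<^bsub>M\<^esub>b\<in>B. r \<odot>\<^bsub>M\<^esub> (c b \<odot>\<^bsub>M\<^esub> b))"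
    using assms B(2) by (intro M.M.finsum_cong') (auto simp: Pi_iff subset_iff M.smult_assoc1)
  also have "\<dots> = r \<odot>\<^bsub>M\<^esub> (\<Oplus>\<^bsub>M\<^esub>b\<in>B. c b \<odot>\<^bsub>M\<^esub> b)"
    using assms B by (intro M.finsum_smult_ldistr[symmetric]) auto
  finally show ?thesis .
qed

lemma lin_comb_single:
  assumes "k \<in> B"
  shows "(\<Oplus>\<^bsub>M\<^esub>b\<in>B. (if b = k then \<one>\<^bsub>R\<^esub> else \<zero>\<^bsub>R\<^esub>) \<odot>\<^bsub>M\<^esub> b) = k"
proof -
  have "(\<Oplus>\<^bsub>M\<^esub>b\<in>B. (if b = k then \<one>\<^bsub>R\<^esub> else \<zero>\<^bsub>R\<^esub>) \<odot>\<^bsub>M\<^esub> b) = (\<Oplus>\<^bsub>M\<^esub>b\<in>B. if k = b then b else \<zero>\<^bsub>M\<^esub>)"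
    using assms B(2) by (intro M.M.finsum_cong') auto
  also have "\<dots> = k"
    using M.M.finsum_singleton[OF assms B(1), of "\<lambda>b. b"] B(2) by auto
  finally show ?thesis .
qed

lemma lin_span_submodule: "submodule (lin_span R M B) R M"
proof (rule M.submoduleI)
  show "lin_span R M B \<subseteq> carrier M" unfolding lin_span_def using lin_comb_closed by blast
  have smult: "r \<odot>\<^bsub>M\<^esub> x \<in> lin_span R M B" if r: "r \<in> carrier R" and x: "x \<in> lin_span R M B" for r x
  proof -
    obtain c where c: "c \<in> B \<rightarrow> carrier R" "x = (\<Oplus>\<^bsub>M\<^esub>b\<in>B. c b \<odot>\<^bsub>M\<^esub> b)"
      using x unfolding lin_span_def by blast
    have "(\<lambda>b. r \<otimes>\<^bsub>R\<^esub> c b) \<in> B \<rightarrow> carrier R" using c(1) r by auto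
    from lin_spanI[where M = M, OF this] show ?thesis unfolding c(2) lin_comb_smult[OF c(1) r] .
  qed
  show "r \<odot>\<^bsub>M\<^esub> x \<in> lin_span R M B" if "r \<in> carrier R" "x \<in> lin_span R M B" for r x
    by (rule smult[OF that])
  have sub: "lin_span R M B \<subseteq> carrier M" unfolding lin_span_def using lin_comb_closed by blast
  show "x \<oplus>\<^bsub>M\<^esub> y \<in> lin_span R M B" if xy: "x \<in> lin_span R M B" "y \<in> lin_span R M B" for x y
  proof -
    obtain c d where c: "c \<in> B \<rightarrow> carrier R" "x = (\<Oplus>\<^bsub>M\<^esub>b\<in>B. c b \<odot>\<^bsub>M\<^esub> b)"
      and d: "d \<in> B \<rightarrow> carrier R" "y = (\<Oplus>\<^bsub>M\<^esub>b\<in>B. d b \<odot>\<^bsub>M\<^esub> b)"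
      using xy unfolding lin_span_def by blast
    have "(\<lambda>b. c b \<oplus>\<^bsub>R\<^esub> d b) \<in> B \<rightarrow> carrier R" using c(1) d(1) by auto
    from lin_spanI[where M = M, OF this] show ?thesis unfolding c(2) d(2) lin_comb_add[OF c(1) d(1)] .
  qed
  show "\<ominus>\<^bsub>M\<^esub> x \<in> lin_span R M B" if "x \<in> lin_span R M B" for x
    using smult[OF _ that, of "\<ominus>\<^bsub>R\<^esub> \<one>\<^bsub>R\<^esub>"] sub that by (auto simp: M.smult_l_minus subset_iff)
  have "(\<Oplus>\<^bsub>M\<^esub>b\<in>B. \<zero>\<^bsub>R\<^esub> \<odot>\<^bsub>M\<^esub> b) = (\<Oplus>\<^bsub>M\<^esub>b\<in>B. \<zero>\<^bsub>M\<^esub>)"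
    using B(2) by (intro M.M.finsum_cong') auto
  then have "\<zero>\<^bsub>M\<^esub> = (\<Oplus>\<^bsub>M\<^esub>b\<in>B. \<zero>\<^bsub>R\<^esub> \<odot>\<^bsub>M\<^esub> b)" by simp
  moreover have "(\<lambda>b. \<zero>\<^bsub>R\<^esub>) \<in> B \<rightarrow> carrier R" by simp
  ultimately show "\<zero>\<^bsub>M\<^esub> \<in> lin_span R M B" using lin_spanI[of "\<lambda>b. \<zero>\<^bsub>R\<^esub>" B R M] by simp
qed

lemma lin_span_superset: "B \<subseteq> lin_span R M B"
proof
  fix k assume "k \<in> B"
  moreover have "(\<lambda>b. if b = k then \<one>\<^bsub>R\<^esub> else \<zero>\<^bsub>R\<^esub>) \<in> B \<rightarrow> carrier R" by auto
  ultimately show "k \<in> lin_span R M B" using lin_spanI[of "\<lambda>b. if b = k then \<one>\<^bsub>R\<^esub> else \<zero>\<^bsub>R\<^esub>" B R M] lin_comb_single[of k] by simp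
qed

lemma lin_span_minimal:
  assumes H: "submodule H R M" "B \<subseteq> H"
  shows "lin_span R M B \<subseteq> H"
proof
  fix x assume "x \<in> lin_span R M B"
  then obtain c where c: "c \<in> B \<rightarrow> carrier R" and x: "x = (\<Oplus>\<^bsub>M\<^esub>b\<in>B. c b \<odot>\<^bsub>M\<^esub> b)"
    unfolding lin_span_def by blast
  have "(\<Oplus>\<^bsub>M\<^esub>b\<in>A. c b \<odot>\<^bsub>M\<^esub> b) \<in> H" if "finite A" "A \<subseteq> B" for A
    using that
  proof (induction A rule: finite_induct)
    case empty
    then show ?case using subgroup.one_closed[OF submodule.axioms(1)[OF H(1)]] by simp
  next
    case (insert b A)
    then have "(\<Oplus>\<^bsub>M\<^esub>b\<in>insert b A. c b \<odot>\<^bsub>M\<^esub> b) = c b \<odot>\<^bsub>M\<^esub> b \<oplus>\<^bsub>M\<^esub> (\<Oplus>\<^bsub>M\<^esub>b\<in>A. c b \<odot>\<^bsub>M\<^esub> b)"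
      using c B(2) by (intro M.M.finsum_insert) auto
    moreover have "c b \<odot>\<^bsub>M\<^esub> b \<in> H" using insert.prems c H by (intro M.submoduleE(4)[OF H(1)]) auto
    ultimately show ?case using insert M.submoduleE(5)[OF H(1)] by auto
  qed
  from this[OF B(1)] show "x \<in> H" unfolding x by simp
qed

lemma coordinates_if_lin_indep:
  assumes indep: "lin_indep R M B"
  shows "\<exists>l. (\<forall>b\<in>B. l b \<in> mod_hom R (M\<lparr>carrier := lin_span R M B\<rparr>) (ideal_module R (carrier R))) \<and>
    (\<forall>x\<in>lin_span R M B. x = (\<Oplus>\<^bsub>M\<^esub>b\<in>B. l b x \<odot>\<^bsub>M\<^esub> b))"
proof -
  let ?S = "lin_span R M B"
  have "\<forall>x\<in>?S. \<exists>c. c \<in> B \<rightarrow> carrier R \<and> x = (\<Oplus>\<^bsub>M\<^esub>b\<in>B. c b \<odot>\<^bsub>M\<^esub> b)"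
    unfolding lin_span_def by blast
  from bchoice[OF this] obtain k
    where k: "\<And>x. x \<in> ?S \<Longrightarrow> k x \<in> B \<rightarrow> carrier R"
      "\<And>x. x \<in> ?S \<Longrightarrow> x = (\<Oplus>\<^bsub>M\<^esub>b\<in>B. k x b \<odot>\<^bsub>M\<^esub> b)" by blast
  have unique: "c b = d b" if c: "c \<in> B \<rightarrow> carrier R" and d: "d \<in> B \<rightarrow> carrier R"
      and eq: "(\<Oplus>\<^bsub>M\<^esub>b\<in>B. c b \<odot>\<^bsub>M\<^esub> b) = (\<Oplus>\<^bsub>M\<^esub>b\<in>B. d b \<odot>\<^bsub>M\<^esub> b)" and b: "b \<in> B" for c d b
  proof -
    let ?m = "\<ominus>\<^bsub>R\<^esub> \<one>\<^bsub>R\<^esub>"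
    have m: "?m \<in> carrier R" by simp
    have md: "(\<lambda>b. ?m \<otimes>\<^bsub>R\<^esub> d b) \<in> B \<rightarrow> carrier R" using d by auto
    have cmd: "(\<lambda>b. c b \<oplus>\<^bsub>R\<^esub> ?m \<otimes>\<^bsub>R\<^esub> d b) \<in> B \<rightarrow> carrier R" using c d by auto
    have "(\<Oplus>\<^bsub>M\<^esub>b\<in>B. (c b \<oplus>\<^bsub>R\<^esub> ?m \<otimes>\<^bsub>R\<^esub> d b) \<odot>\<^bsub>M\<^esub> b) = \<zero>\<^bsub>M\<^esub>"
      unfolding lin_comb_add[OF c md] lin_comb_smult[OF d m] eq
      using lin_comb_closed[OF d] by (simp add: M.smult_l_minus M.M.r_neg)
    then have "c b \<oplus>\<^bsub>R\<^esub> ?m \<otimes>\<^bsub>R\<^esub> d b = \<zero>\<^bsub>R\<^esub>"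
      using indep[unfolded lin_indep_def, rule_format, OF cmd _ b] by simp
    moreover have "c b \<in> carrier R" "d b \<in> carrier R" using c d b by auto
    ultimately show ?thesis
      using M.R.minus_equality[of "c b" "\<ominus>\<^bsub>R\<^esub> d b"] by (simp add: M.R.l_minus)
  qed
  note S = M.submoduleE[OF lin_span_submodule]
  have "(\<lambda>x. k x b) \<in> mod_hom R (M\<lparr>carrier := ?S\<rparr>) (ideal_module R (carrier R))" if b: "b \<in> B" for b
  proof (rule mod_homI)
    fix x assume x: "x \<in> carrier (M\<lparr>carrier := ?S\<rparr>)"
    then show "k x b \<in> carrier (ideal_module R (carrier R))"
      using k(1)[of x] b by (auto simp: ideal_module_def)
    show "k (r \<odot>\<^bsub>M\<lparr>carrier := ?S\<rparr>\<^esub> x) b = r \<odot>\<^bsub>ideal_module R (carrier R)\<^esub> k x b"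
      if r: "r \<in> carrier R" for r
    proof -
      have x: "x \<in> ?S" "r \<odot>\<^bsub>M\<^esub> x \<in> ?S" using x S(4)[OF r] by auto
      have "k (r \<odot>\<^bsub>M\<^esub> x) b = (\<lambda>b. r \<otimes>\<^bsub>R\<^esub> k x b) b"
      proof (rule unique[OF k(1)[OF x(2)] _ _ b])
        show "(\<lambda>b. r \<otimes>\<^bsub>R\<^esub> k x b) \<in> B \<rightarrow> carrier R" using k(1)[OF x(1)] r by auto
        show "(\<Oplus>\<^bsub>M\<^esub>b\<in>B. k (r \<odot>\<^bsub>M\<^esub> x) b \<odot>\<^bsub>M\<^esub> b) = (\<Oplus>\<^bsub>M\<^esub>b\<in>B. (r \<otimes>\<^bsub>R\<^esub> k x b) \<odot>\<^bsub>M\<^esub> b)"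
          unfolding lin_comb_smult[OF k(1)[OF x(1)] r] k(2)[OF x(1), symmetric] k(2)[OF x(2), symmetric] ..
      qed
      then show ?thesis by (simp add: ideal_module_def)
    qed
    fix y assume y: "y \<in> carrier (M\<lparr>carrier := ?S\<rparr>)"
    have xy: "x \<in> ?S" "y \<in> ?S" "x \<oplus>\<^bsub>M\<^esub> y \<in> ?S" using x y S(5) by auto
    have "k (x \<oplus>\<^bsub>M\<^esub> y) b = (\<lambda>b. k x b \<oplus>\<^bsub>R\<^esub> k y b) b"
    proof (rule unique[OF k(1)[OF xy(3)] _ _ b])
      show "(\<lambda>b. k x b \<oplus>\<^bsub>R\<^esub> k y b) \<in> B \<rightarrow> carrier R" using k(1)[OF xy(1)] k(1)[OF xy(2)] by auto
      show "(\<Oplus>\<^bsub>M\<^esub>b\<in>B. k (x \<oplus>\<^bsub>M\<^esub> y) b \<odot>\<^bsub>M\<^esub> b) = (\<Oplus>\<^bsub>M\<^esub>b\<in>B. (k x b \<oplus>\<^bsub>R\<^esub> k y b) \<odot>\<^bsub>M\<^esub> b)"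
        unfolding lin_comb_add[OF k(1)[OF xy(1)] k(1)[OF xy(2)]] k(2)[OF xy(1), symmetric]
          k(2)[OF xy(2), symmetric] k(2)[OF xy(3), symmetric] ..
    qed
    then show "k (x \<oplus>\<^bsub>M\<lparr>carrier := ?S\<rparr>\<^esub> y) b = k x b \<oplus>\<^bsub>ideal_module R (carrier R)\<^esub> k y b"
      by (simp add: ideal_module_def)
  qed
  then show ?thesis using k(2) by (intro exI[of _ "\<lambda>b x. k x b"]) blast
qed

end

lemma flat_module_if_locally_free:
  fixes R :: "('a, 'b) ring_scheme" and M :: "('a, 'm) module"
  assumes M: "module R M"
    and loc: "\<And>X. finite X \<Longrightarrow> X \<subseteq> carrier M \<Longrightarrow>
      \<exists>B. finite B \<and> B \<subseteq> carrier M \<and> X \<subseteq> lin_span R M B \<and> lin_indep R M B"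
  shows "flat_module TYPE('n) TYPE('p) R M"
proof (rule flat_module_if_locally_dual_basis[OF M])
  fix X assume "finite X" "X \<subseteq> carrier M"
  from loc[OF this] obtain B where B: "finite B" "B \<subseteq> carrier M" "X \<subseteq> lin_span R M B" "lin_indep R M B"
    by blast
  then show "\<exists>H B l. submodule H R M \<and> X \<subseteq> H \<and> finite B \<and> B \<subseteq> H \<and>
      (\<forall>b\<in>B. l b \<in> mod_hom R (M\<lparr>carrier := H\<rparr>) (ideal_module R (carrier R))) \<and>
      (\<forall>x\<in>H. x = (\<Oplus>\<^bsub>M\<^esub>b\<in>B. l b x \<odot>\<^bsub>M\<^esub> b))"
    using lin_span_submodule[OF M B(1,2)] lin_span_superset[OF M B(1,2)]
      coordinates_if_lin_indep[OF M B(1,2,4)] by blast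
qed

text \<open>A finite nonempty set has a least element for a total divisibility preorder.\<close>

lemma exists_dividing_coefficient:
  assumes "cring R" and total: "\<And>c d. c \<in> carrier R \<Longrightarrow> d \<in> carrier R \<Longrightarrow>
      (\<exists>t\<in>carrier R. c = t \<otimes>\<^bsub>R\<^esub> d) \<or> (\<exists>t\<in>carrier R. d = t \<otimes>\<^bsub>R\<^esub> c)"
    and "finite B" "B \<noteq> {}" "c \<in> B \<rightarrow> carrier R"
  shows "\<exists>k\<in>B. \<forall>b\<in>B. \<exists>t\<in>carrier R. c b = t \<otimes>\<^bsub>R\<^esub> c k"
  using assms(3-)
proof (induction B rule: finite_ne_induct)
  case (singleton b)
  interpret cring R by fact
  have "c b = \<one>\<^bsub>R\<^esub> \<otimes>\<^bsub>R\<^esub> c b" using singleton by auto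
  then show ?case by blast
next
  case (insert b B)
  interpret cring R by fact
  obtain k where k: "k \<in> B" "\<forall>b\<in>B. \<exists>t\<in>carrier R. c b = t \<otimes>\<^bsub>R\<^esub> c k" using insert by auto
  have cl: "c b \<in> carrier R" "c k \<in> carrier R" using insert.prems k(1) by auto
  from total[OF cl] show ?case
  proof
    assume "\<exists>t\<in>carrier R. c b = t \<otimes>\<^bsub>R\<^esub> c k"
    then show ?thesis using k by blast
  next
    assume "\<exists>t\<in>carrier R. c k = t \<otimes>\<^bsub>R\<^esub> c b"
    then obtain t where t: "t \<in> carrier R" "c k = t \<otimes>\<^bsub>R\<^esub> c b" by blast
    have "\<exists>u\<in>carrier R. c b' = u \<otimes>\<^bsub>R\<^esub> c b" if b': "b' \<in> insert b B" for b'
    proof (cases "b' = b")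
      case True
      then show ?thesis using cl by (intro bexI[of _ "\<one>\<^bsub>R\<^esub>"]) auto
    next
      case False
      then obtain s where "s \<in> carrier R" "c b' = s \<otimes>\<^bsub>R\<^esub> c k" using k(2) b' by blast
      then show ?thesis using t cl by (intro bexI[of _ "s \<otimes>\<^bsub>R\<^esub> t"]) (auto simp: m_assoc)
    qed
    then show ?thesis by blast
  qed
qed

text \<open>Let \<open>B\<close> be a generating set of least cardinality among those whose span contains \<open>X\<close>. In a nontrivial
  linear relation on \<open>B\<close>, some coefficient divides all others; by torsion-freeness it can be cancelled,
  which makes its basis element a combination of the others and contradicts minimality.\<close>

lemma torsion_free_flat:
  fixes R :: "('a, 'b) ring_scheme" and M :: "('a, 'm) module"
  assumes M: "module R M"
    and total: "\<And>c d. c \<in> carrier R \<Longrightarrow> d \<in> carrier R \<Longrightarrow>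
      (\<exists>t\<in>carrier R. c = t \<otimes>\<^bsub>R\<^esub> d) \<or> (\<exists>t\<in>carrier R. d = t \<otimes>\<^bsub>R\<^esub> c)"
    and torsion_free: "\<And>r x. r \<in> carrier R \<Longrightarrow> x \<in> carrier M \<Longrightarrow> r \<odot>\<^bsub>M\<^esub> x = \<zero>\<^bsub>M\<^esub> \<Longrightarrow>
      r = \<zero>\<^bsub>R\<^esub> \<or> x = \<zero>\<^bsub>M\<^esub>"
  shows "flat_module TYPE('n) TYPE('p) R M"
proof (rule flat_module_if_locally_free[OF M])
  interpret M: module R M by (rule M)
  fix X assume X: "finite X" "X \<subseteq> carrier M"
  let ?P = "\<lambda>B. finite B \<and> B \<subseteq> carrier M \<and> X \<subseteq> lin_span R M B"
  have "?P X" using X lin_span_superset[OF M X] by blast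
  then obtain B where B: "finite B" "B \<subseteq> carrier M" "X \<subseteq> lin_span R M B"
    and min: "\<And>B'. ?P B' \<Longrightarrow> card B \<le> card B'"
    using ex_has_least_nat[of ?P X card] by blast
  have "lin_indep R M B"
    unfolding lin_indep_def
  proof (intro ballI impI)
    fix c b assume c: "c \<in> B \<rightarrow> carrier R" and 0: "(\<Oplus>\<^bsub>M\<^esub>b\<in>B. c b \<odot>\<^bsub>M\<^esub> b) = \<zero>\<^bsub>M\<^esub>" and b: "b \<in> B"
    obtain k where k: "k \<in> B" "\<forall>b\<in>B. \<exists>t\<in>carrier R. c b = t \<otimes>\<^bsub>R\<^esub> c k"
      using exists_dividing_coefficient[OF M.R.is_cring total B(1) _ c] b by blast
    have kc: "k \<in> carrier M" "c k \<in> carrier R" using k(1) c B(2) by auto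
    have fin: "finite (B - {k})" "B - {k} \<subseteq> carrier M" using B by auto
    let ?S = "lin_span R M (B - {k})"
    note S = lin_span_submodule[OF M fin]
    show "c b = \<zero>\<^bsub>R\<^esub>"
    proof (rule ccontr)
      assume "c b \<noteq> \<zero>\<^bsub>R\<^esub>"
      then have ck: "c k \<noteq> \<zero>\<^bsub>R\<^esub>" using k(2) b by force
      obtain t where t: "\<And>b. b \<in> B \<Longrightarrow> t b \<in> carrier R" "\<And>b. b \<in> B \<Longrightarrow> c b = t b \<otimes>\<^bsub>R\<^esub> c k"
        using bchoice[of B "\<lambda>b t. t \<in> carrier R \<and> c b = t \<otimes>\<^bsub>R\<^esub> c k"] k(2) by blast
      let ?y = "\<Oplus>\<^bsub>M\<^esub>b\<in>B - {k}. t b \<odot>\<^bsub>M\<^esub> b"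
      have t': "t \<in> (B - {k}) \<rightarrow> carrier R" using t(1) by auto
      have y: "?y \<in> ?S" by (rule lin_spanI[OF t'])
      have yc: "?y \<in> carrier M" by (rule lin_comb_closed[OF M fin t'])
      have "(\<Oplus>\<^bsub>M\<^esub>b\<in>B. c b \<odot>\<^bsub>M\<^esub> b) = c k \<odot>\<^bsub>M\<^esub> k \<oplus>\<^bsub>M\<^esub> (\<Oplus>\<^bsub>M\<^esub>b\<in>B - {k}. c b \<odot>\<^bsub>M\<^esub> b)"
        using M.M.finsum_insert[of "B - {k}" k "\<lambda>b. c b \<odot>\<^bsub>M\<^esub> b"] fin c kc insert_Diff[OF k(1)]
        by (auto simp: Pi_iff subset_iff)
      also have "(\<Oplus>\<^bsub>M\<^esub>b\<in>B - {k}. c b \<odot>\<^bsub>M\<^esub> b) = (\<Oplus>\<^bsub>M\<^esub>b\<in>B - {k}. (c k \<otimes>\<^bsub>R\<^esub> t b) \<odot>\<^bsub>M\<^esub> b)"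
        using fin t kc by (intro M.M.finsum_cong') (auto simp: M.R.m_comm subset_iff)
      also have "\<dots> = c k \<odot>\<^bsub>M\<^esub> ?y" by (rule lin_comb_smult[OF M fin t' kc(2)])
      finally have "c k \<odot>\<^bsub>M\<^esub> (k \<oplus>\<^bsub>M\<^esub> ?y) = \<zero>\<^bsub>M\<^esub>" using 0 kc yc by (simp add: M.smult_r_distr)
      then have "k \<oplus>\<^bsub>M\<^esub> ?y = \<zero>\<^bsub>M\<^esub>" using torsion_free[OF kc(2)] ck kc yc by blast
      then have "k = \<ominus>\<^bsub>M\<^esub> ?y" using M.M.minus_equality[of k ?y] kc yc by simp
      then have "k \<in> ?S" using M.submoduleE(3)[OF S y] by simp
      then have "B \<subseteq> ?S" using lin_span_superset[OF M fin] by blast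
      then have "X \<subseteq> ?S" using lin_span_minimal[OF M B(1,2) S] B(3) by blast
      then have "card B \<le> card (B - {k})" using min[of "B - {k}"] fin by blast
      then show False using card_Diff1_less[OF B(1) k(1)] by simp
    qed
  qed
  then show "\<exists>B. finite B \<and> B \<subseteq> carrier M \<and> X \<subseteq> lin_span R M B \<and> lin_indep R M B"
    using B by blast
qed


section \<open>Ideals modulo their annihilators\<close>

theorem (in local_fqf_ring) ideal_flat_mod_annihilator:
  assumes chain: "\<not> chain_ring R" and I: "ideal I R"
  shows "flat_module TYPE('n) TYPE('p) (R Quot annihilator R I) (ideal_mod_annihilator R I)"
proof -
  let ?A = "annihilator R I" and ?M = "ideal_mod_annihilator R I"
  let ?S = "R Quot ?A"
  interpret A: ideal ?A R by (rule ideal_annihilator[OF is_cring I])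
  note mod = module_ideal_mod_annihilator[OF is_cring I]
  interpret M: module ?S ?M by (rule mod)
  note act = smult_ideal_mod_annihilator[OF is_cring I]
  have Icarr: "x \<in> carrier R" if "x \<in> I" for x by (rule ideal.Icarr[OF I that])
  have M_simps: "carrier ?M = I" "\<zero>\<^bsub>?M\<^esub> = \<zero>" by (simp_all add: ideal_mod_annihilator_def)
  have rep: "\<exists>r\<in>carrier R. C = ?A +> r" if "C \<in> carrier ?S" for C
    using that by (auto simp: FactRing_def A_RCOSETS_def')
  have coset: "?A +> r \<in> carrier ?S" if "r \<in> carrier R" for r
    using that by (auto simp: FactRing_def A_RCOSETS_def')
  have mult: "(?A +> r) \<otimes>\<^bsub>?S\<^esub> (?A +> s) = ?A +> (r \<otimes> s)" if "r \<in> carrier R" "s \<in> carrier R" for r s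
    using that by (simp add: FactRing_def A.rcoset_mult_add)
  have zero: "?A +> r = \<zero>\<^bsub>?S\<^esub>" if "r \<in> ?A" for r
    using a_coset_join2[OF A.Icarr[OF that] A.a_subgroup that] by (simp add: FactRing_def)
  show ?thesis
  proof (cases "\<exists>g\<in>I. \<forall>r\<in>carrier R. r \<otimes> g = \<zero> \<longrightarrow> r = \<zero>")
    case True
    then obtain g\<^sub>0 where g\<^sub>0: "g\<^sub>0 \<in> I" "\<And>r. r \<in> carrier R \<Longrightarrow> r \<otimes> g\<^sub>0 = \<zero> \<Longrightarrow> r = \<zero>" by blast
    show ?thesis
    proof (rule flat_module_if_locally_free[OF mod])
      fix X assume "finite X" "X \<subseteq> carrier ?M"
      then obtain g where g: "g \<in> I" "\<forall>r\<in>carrier R. r \<otimes> g = \<zero> \<longrightarrow> r = \<zero>" "X \<subseteq> PIdl g"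
        using regular_finite_subset_principal[OF I g\<^sub>0] M_simps by metis
      have single: "(\<Oplus>\<^bsub>?M\<^esub>b\<in>{g}. c b \<odot>\<^bsub>?M\<^esub> b) = c g \<odot>\<^bsub>?M\<^esub> g" if "c g \<in> carrier ?S" for c
        using M.M.finsum_insert[of "{}" g "\<lambda>b. c b \<odot>\<^bsub>?M\<^esub> b"] M.smult_closed[OF that, of g] g(1) M_simps(1)
        by simp
      have "X \<subseteq> lin_span ?S ?M {g}"
      proof
        fix x assume "x \<in> X"
        then obtain r where r: "r \<in> carrier R" "x = r \<otimes> g" using g(3) mem_cgenideal by blast
        have "(\<Oplus>\<^bsub>?M\<^esub>b\<in>{g}. (?A +> r) \<odot>\<^bsub>?M\<^esub> b) = x"
          using single[of "\<lambda>_. ?A +> r"] coset[OF r(1)] act[OF r(1) g(1)] r(2) by simp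
        then show "x \<in> lin_span ?S ?M {g}"
          using lin_spanI[of "\<lambda>_. ?A +> r" "{g}" ?S ?M] coset[OF r(1)] by simp
      qed
      moreover have "lin_indep ?S ?M {g}"
        unfolding lin_indep_def
      proof (intro ballI impI)
        fix c b assume c: "c \<in> {g} \<rightarrow> carrier ?S" and 0: "(\<Oplus>\<^bsub>?M\<^esub>b\<in>{g}. c b \<odot>\<^bsub>?M\<^esub> b) = \<zero>\<^bsub>?M\<^esub>"
          and b: "b \<in> {g}"
        have cg: "c g \<in> carrier ?S" using c by auto
        then obtain r where r: "r \<in> carrier R" "c g = ?A +> r" using rep by blast
        have "r \<otimes> g = \<zero>" using 0 single[of c, OF cg] act[OF r(1) g(1)] r(2) M_simps(2) by simp
        then have "r = \<zero>" using g(2) r(1) by blast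
        then show "c b = \<zero>\<^bsub>?S\<^esub>" using zero[of \<zero>] r(2) b by simp
      qed
      ultimately show "\<exists>B. finite B \<and> B \<subseteq> carrier ?M \<and> X \<subseteq> lin_span ?S ?M B \<and> lin_indep ?S ?M B"
        using g(1) M_simps(1) by (intro exI[of _ "{g}"]) simp
    qed
  next
    case False
    then have nonreg: "\<forall>x\<in>I. \<exists>r\<in>carrier R. r \<otimes> x = \<zero> \<and> r \<noteq> \<zero>" by blast
    note tf = torsion_free_mod_annihilator[OF chain I nonreg]
    show ?thesis
    proof (rule torsion_free_flat[OF mod])
      fix C D assume "C \<in> carrier ?S" "D \<in> carrier ?S"
      then obtain c d where c: "c \<in> carrier R" "C = ?A +> c" and d: "d \<in> carrier R" "D = ?A +> d"
        using rep by meson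
      have div: "\<exists>T\<in>carrier ?S. ?A +> x = T \<otimes>\<^bsub>?S\<^esub> (?A +> y)" if "x \<in> PIdl y" "y \<in> carrier R" for x y
        using that coset mult unfolding mem_cgenideal by metis
      consider "c \<in> PIdl d" | "d \<in> PIdl c" | "c \<in> ?A" using tf(2)[OF c(1) d(1)] by blast
      then show "(\<exists>T\<in>carrier ?S. C = T \<otimes>\<^bsub>?S\<^esub> D) \<or> (\<exists>T\<in>carrier ?S. D = T \<otimes>\<^bsub>?S\<^esub> C)"
      proof cases
        case 1
        then show ?thesis using div c d by simp
      next
        case 2
        then show ?thesis using div c d by simp
      next
        case 3
        have "C = \<zero>\<^bsub>?S\<^esub> \<otimes>\<^bsub>?S\<^esub> D" using zero[OF 3] c d coset[OF d(1)] by simp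
        then show ?thesis by (intro disjI1 bexI[of _ "\<zero>\<^bsub>?S\<^esub>"]) auto
      qed
    next
      fix C x assume "C \<in> carrier ?S" "x \<in> carrier ?M" and 0: "C \<odot>\<^bsub>?M\<^esub> x = \<zero>\<^bsub>?M\<^esub>"
      then obtain r where r: "r \<in> carrier R" "C = ?A +> r" and x: "x \<in> I" using rep M_simps(1) by auto
      have "r \<otimes> x = \<zero>" using 0 act[OF r(1) x] r(2) M_simps(2) by simp
      then have "r \<in> ?A \<or> x = \<zero>" using tf(1)[OF r(1) x] by blast
      then show "C = \<zero>\<^bsub>?S\<^esub> \<or> x = \<zero>\<^bsub>?M\<^esub>" using zero r(2) M_simps(2) by auto
    qed
  qed
qed

theorem corollary2p13:
  fixes R :: "('a, 'b) ring_scheme" and I :: "'a set"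
  assumes "local_ring R"
    and "fqf_ring R"
    and "\<not> chain_ring R"
    and "ideal I R"
  shows "flat_module TYPE('n) TYPE('p) (R Quot annihilator R I) (ideal_mod_annihilator R I)"
proof -
  interpret cring R using assms(1) by (simp add: local_ring_def)
  interpret local_fqf_ring R by unfold_locales (fact assms)+
  show ?thesis by (rule ideal_flat_mod_annihilator[OF assms(3,4)])
qed

end
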